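(* Let $n$ and $m$ be positive integers and let $z_j:=(z_{j,1},\dots,z_{j,n})$, $j=1,\dots,m$, be distinct points in $\mathbb B_n$, the open unit ball of $\mathbb C^n$. Let $\mathcal H,\mathcal K,\mathcal Y_1,\dots,\mathcal Y_m$ be Hilbert spaces and let $B_j\in B(\mathcal K,\mathcal Y_j)$, $C_j\in B(\mathcal H,\mathcal Y_j)$, $j=1,\dots,m$, be bounded operators. Then, given a nonnegative integer $k$, there exists an operator $\theta\in B(\mathcal H,F^2(H_n)\otimes\mathcal K)$ such that $$B_j\theta(z_j)=C_j,\quad j=1,\dots,m,\qquad\text{and}\qquad\|M_\theta\|_{\mathcal P_k}\le1$$ if and only if $$\left[\frac{B_jB_q^*}{1-\langle z_j,z_q\rangle}\right]_{j,q=1}^m\ \ge\ \left[\frac{(1-\langle z_j,z_q\rangle^{k+1})\,C_jC_q^*}{1-\langle z_j,z_q\rangle}\right]_{j,q=1}^m .$$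
   Context: $H_n$ is an $n$-dimensional complex Hilbert space with orthonormal basis $e_1,\dots,e_n$; the full Fock space is $F^2(H_n)=\bigoplus_{p\ge0}H_n^{\otimes p}$ with $H_n^{\otimes0}=\mathbb C1$, and $S_i\psi=e_i\otimes\psi$ are the left creation operators. $\mathbb F_n^+$ is the free monoid on generators $g_1,\dots,g_n$ with identity $g_0$; for $\alpha=g_{i_1}\cdots g_{i_p}$, $e_\alpha=e_{i_1}\otimes\cdots\otimes e_{i_p}$, $S_\alpha=S_{i_1}\cdots S_{i_p}$ and, for $z=(z_1,\dots,z_n)\in\mathbb C^n$, $z_\alpha=z_{i_1}\cdots z_{i_p}$; $e_{g_0}=1$, $S_{g_0}=I$, $z_{g_0}=1$. $\mathcal P_k=\bigoplus_{p=0}^kH_n^{\otimes p}$ is the space of polynomials of degree $\le k$ in $F^2(H_n)$. Every $\theta\in B(\mathcal H,F^2(H_n)\otimes\mathcal K)$ is uniquely represented as $\theta h=\sum_{\alpha\in\mathbb F_n^+}e_\alpha\otimes A_{(\alpha)}h$ with $A_{(\alpha)}\in B(\mathcal H,\mathcal K)$; its evaluation at $z\in\mathbb B_n$ is the norm-convergent series $\theta(z)=\sum_{p=0}^\infty\sum_{|\alpha|=p}z_\alpha A_{(\alpha)}\in B(\mathcal H,\mathcal K)$, where $|\alpha|$ is the length of $\alpha$. $M_\theta$ is the linear map (possibly unbounded, defined on polynomials with coefficients in $\mathcal H$) determined by $M_\theta(e_\alpha\otimes h)=(S_\alpha\otimes I_{\mathcal K})\theta h$; its restriction to $\mathcal P_k\otimes\mathcal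 H$ is bounded, and $\|M_\theta\|_{\mathcal P_k}:=\sup\{\|M_\theta q\|:q\in\mathcal P_k\otimes\mathcal H,\ \|q\|\le1\}$. The inner product is $\langle z,w\rangle=\sum_{i=1}^nz_i\overline{w_i}$. The operator matrices act on $\bigoplus_{j=1}^m\mathcal Y_j$, with the $(j,q)$ entry mapping $\mathcal Y_q$ to $\mathcal Y_j$, and $\ge$ is the order of self-adjoint operators. *)

theory Defs
  imports "HOL-Analysis.Analysis"
begin

section \<open>Complex Hilbert spaces\<close>

class scaleC =
  fixes scaleC :: "complex \<Rightarrow> 'a \<Rightarrow> 'a"  (infixr "*\<^sub>C" 75)

text \<open>
  A complex Hilbert space is presented as a complete real inner product space (so that the
  library's norm, topology and limits apply) together with a compatible complex scalar
  multiplication and a complex inner product whose real part is the real one.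
  The complex inner product is linear in its \<^emph>\<open>first\<close> argument.
\<close>

class complex_hilbert = real_inner + complete_space + scaleC +
  fixes cinner :: "'a \<Rightarrow> 'a \<Rightarrow> complex"
  assumes scaleC_add_right: "a *\<^sub>C (x + y) = a *\<^sub>C x + a *\<^sub>C y"
    and scaleC_add_left: "(a + b) *\<^sub>C x = a *\<^sub>C x + b *\<^sub>C x"
    and scaleC_scaleC: "a *\<^sub>C (b *\<^sub>C x) = (a * b) *\<^sub>C x"
    and scaleR_scaleC: "r *\<^sub>R x = complex_of_real r *\<^sub>C x"
    and cinner_commute: "cinner x y = cnj (cinner y x)"
    and cinner_add_left: "cinner (x + y) w = cinner x w + cinner y w"
    and cinner_scaleC_left: "cinner (a *\<^sub>C x) y = a * cinner x y"
    and inner_eq_Re_cinner: "inner x y = Re (cinner x y)"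

lemma cinner_scaleC_right: "cinner x (a *\<^sub>C y) = cnj a * cinner x (y :: 'a :: complex_hilbert)"
  by (metis cinner_commute cinner_scaleC_left complex_cnj_cnj complex_cnj_mult)

lemma cinner_add_right: "cinner w (x + y) = cinner w x + cinner w (y :: 'a :: complex_hilbert)"
  by (metis cinner_commute cinner_add_left complex_cnj_add)

lemma Im_cinner: "Im (cinner x y) = Re (cinner x (\<i> *\<^sub>C (y :: 'a :: complex_hilbert)))"
  by (simp add: cinner_scaleC_right)

lemma scaleC_zero_left [simp]: "0 *\<^sub>C (x :: 'a :: complex_hilbert) = 0"
  using scaleR_scaleC[of 0 x] by simp

lemma scaleC_one [simp]: "1 *\<^sub>C (x :: 'a :: complex_hilbert) = x"
  using scaleR_scaleC[of 1 x] by simp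

lemma scaleC_zero_right [simp]: "a *\<^sub>C (0 :: 'a :: complex_hilbert) = 0"
  using scaleC_add_right[of a 0 0] by simp

lemma cinner_eq_inner:
  "cinner x y = Complex (inner x y) (inner x (\<i> *\<^sub>C (y :: 'a :: complex_hilbert)))"
  by (simp add: inner_eq_Re_cinner Im_cinner complex_eq_iff)

lemma cinner_self: "cinner x x = complex_of_real ((norm (x :: 'a :: complex_hilbert))\<^sup>2)"
proof -
  have "Im (cinner x x) = 0"
    using arg_cong[OF cinner_commute[of x x], of Im] by simp
  then show ?thesis
    by (simp add: complex_eq_iff flip: inner_eq_Re_cinner) (simp add: power2_norm_eq_inner)
qed

lemma norm_scaleC: "norm (a *\<^sub>C x) = cmod a * norm (x :: 'a :: complex_hilbert)"
proof -
  have "cinner (a *\<^sub>C x) (a *\<^sub>C x) = (a * cnj a) * cinner x x"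
    by (simp add: cinner_scaleC_left cinner_scaleC_right)
  then have "complex_of_real ((norm (a *\<^sub>C x))\<^sup>2) = complex_of_real ((cmod a * norm x)\<^sup>2)"
    by (simp only: cinner_self complex_norm_square[symmetric] of_real_mult power_mult_distrib
        of_real_power)
  then have "(norm (a *\<^sub>C x))\<^sup>2 = (cmod a * norm x)\<^sup>2"
    by (simp only: of_real_eq_iff)
  then show ?thesis
    by (simp add: power2_eq_iff_nonneg)
qed

lemma bounded_linear_scaleC: "bounded_linear (\<lambda>x :: 'a :: complex_hilbert. a *\<^sub>C x)"
proof
  show "a *\<^sub>C (x + y) = a *\<^sub>C x + a *\<^sub>C y" for x y :: 'a
    by (rule scaleC_add_right)
  show "a *\<^sub>C (r *\<^sub>R x) = r *\<^sub>R (a *\<^sub>C x)" for r and x :: 'a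
    by (simp add: scaleR_scaleC scaleC_scaleC mult.commute)
  show "\<exists>K. \<forall>x :: 'a. norm (a *\<^sub>C x) \<le> norm x * K"
    by (intro exI[of _ "cmod a"]) (simp add: norm_scaleC mult.commute)
qed

instantiation complex :: complex_hilbert
begin
definition scaleC_complex_def: "a *\<^sub>C (x :: complex) = a * x"
definition cinner_complex_def: "cinner (x :: complex) y = x * cnj y"
instance
  by standard (auto simp: scaleC_complex_def cinner_complex_def algebra_simps scaleR_conv_of_real
      inner_complex_def)
end

instantiation vec :: (complex_hilbert, finite) complex_hilbert
begin
definition scaleC_vec_def: "a *\<^sub>C (x :: 'a ^ 'b) = (\<chi> i. a *\<^sub>C (x $ i))"
definition cinner_vec_def: "cinner (x :: 'a ^ 'b) y = (\<Sum>i\<in>UNIV. cinner (x $ i) (y $ i))"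
instance
proof
  fix x y w :: "'a ^ 'b" and a b :: complex and r :: real
  show "cinner x y = cnj (cinner y x)"
    unfolding cinner_vec_def cnj_sum by (intro sum.cong refl cinner_commute)
qed (simp_all add: scaleC_vec_def cinner_vec_def vec_eq_iff scaleC_add_right scaleC_add_left
      scaleC_scaleC scaleR_scaleC cinner_add_left cinner_scaleC_left sum.distrib sum_distrib_left
      inner_vec_def inner_eq_Re_cinner)
end

lemma cinner_Cn: "cinner (z :: complex ^ 'n) w = (\<Sum>i\<in>UNIV. z $ i * cnj (w $ i))"
  by (simp add: cinner_vec_def cinner_complex_def)


section \<open>Bounded operators\<close>

text \<open>
  Library type \<open>'a \<Rightarrow>\<^sub>L 'b\<close> consists of the bounded \<^emph>\<open>real\<close>-linear maps with the operator norm.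
  The set \<open>bounded_ops Y\<close> consists of the bounded complex-linear operators into the
  subspace \<open>Y\<close>; so \<open>B(H,K)\<close> is \<open>bounded_ops UNIV\<close>.
\<close>

definition bounded_ops :: "'b set \<Rightarrow> ('a::complex_hilbert \<Rightarrow>\<^sub>L 'b::complex_hilbert) set" where
  "bounded_ops Y = {T. (\<forall>c x. blinfun_apply T (c *\<^sub>C x) = c *\<^sub>C blinfun_apply T x) \<and>
                       range (blinfun_apply T) \<subseteq> Y}"

text \<open>
  A closed complex subspace is a Hilbert space with the inherited inner product. Every family of
  Hilbert spaces is, up to unitary equivalence, a family of closed subspaces of one Hilbert
  space (their orthogonal sum); this is how families of different spaces are represented.
\<close>

definition hilbert_subspace :: "'a::complex_hilbert set \<Rightarrow> bool" where
  "hilbert_subspace Y \<longleftrightarrow> closed Y \<and> 0 \<in> Y \<and> (\<forall>x\<in>Y. \<forall>y\<in>Y. x + y \<in> Y) \<and>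
     (\<forall>c. \<forall>x\<in>Y. c *\<^sub>C x \<in> Y)"

instantiation blinfun :: (real_normed_vector, complex_hilbert) scaleC
begin
lift_definition scaleC_blinfun :: "complex \<Rightarrow> 'a \<Rightarrow>\<^sub>L 'b \<Rightarrow> 'a \<Rightarrow>\<^sub>L 'b" is "\<lambda>c T x. c *\<^sub>C T x"
  by (rule bounded_linear_compose[OF bounded_linear_scaleC])
instance ..
end

text \<open>
  The Hilbert space adjoint. If \<open>T\<close> maps into a closed subspace \<open>Y\<close>, the adjoint of \<open>T\<close> as an
  operator into \<open>Y\<close> is the restriction of \<open>cadj T\<close> to \<open>Y\<close>.
\<close>

definition cadj :: "('a::complex_hilbert \<Rightarrow>\<^sub>L 'b::complex_hilbert) \<Rightarrow> 'b \<Rightarrow>\<^sub>L 'a" where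
  "cadj T = (THE S. \<forall>x y. cinner (blinfun_apply T x) y = cinner x (blinfun_apply S y))"

lemma riesz:
  fixes f :: "'a::{real_inner,complete_space} \<Rightarrow> real"
  assumes "bounded_linear f"
  obtains u where "\<And>x. f x = inner x u"
proof -
  interpret f: bounded_linear f by fact
  obtain K where K: "\<And>x. norm (f x) \<le> norm x * K" "K > 0"
    using f.pos_bounded by blast
  define g where "g x = (norm x)\<^sup>2 - 2 * f x" for x
  have lb: "g x \<ge> - K\<^sup>2" for x
  proof -
    have "f x \<le> norm x * K" using K(1)[of x] by simp
    moreover have "0 \<le> (norm x - K)\<^sup>2" by simp
    ultimately show ?thesis by (simp add: g_def power2_diff)
  qed
  have bdd: "bdd_below (range g)"
    using lb by (auto intro!: bdd_belowI)
  define I where "I = Inf (range g)"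
  have Ile: "I \<le> g x" for x
    unfolding I_def by (rule cInf_lower[OF _ bdd]) simp
  have "\<exists>x. g x < I + 1 / Suc n" for n
    using cInf_lessD[of "range g" "I + 1 / Suc n"] by (auto simp: I_def)
  then obtain X where X: "\<And>n. g (X n) < I + 1 / Suc n" by metis
  have para: "(norm (x - y))\<^sup>2 = 2 * g x + 2 * g y - 4 * g ((1/2) *\<^sub>R (x + y))" for x y
    by (simp add: g_def power2_norm_eq_inner algebra_simps inner_commute f.add f.scaleR
        power_divide power_mult_distrib)
  have "Cauchy X"
  proof (rule metric_CauchyI)
    fix e :: real assume e: "e > 0"
    obtain N where N: "4 / e\<^sup>2 < real N" using reals_Archimedean2 by blast
    have "dist (X m) (X n) < e" if "m \<ge> N" "n \<ge> N" for m n
    proof -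
      have Npos: "0 < real N" using N e by (smt (verit) zero_less_divide_iff zero_less_power)
      have "1 / real (Suc m) \<le> 1 / real N" "1 / real (Suc n) \<le> 1 / real N"
        using that Npos by (auto intro!: divide_left_mono)
      then have "(norm (X m - X n))\<^sup>2 < 4 / real N"
        unfolding para using X[of m] X[of n] Ile[of "(1/2) *\<^sub>R (X m + X n)"] by linarith
      also have "\<dots> < e\<^sup>2" using N Npos e by (simp add: field_simps)
      finally show ?thesis
        using e by (simp add: dist_norm power2_less_imp_less)
    qed
    then show "\<exists>M. \<forall>m\<ge>M. \<forall>n\<ge>M. dist (X m) (X n) < e" by blast
  qed
  then obtain u where u: "X \<longlonglongrightarrow> u"
    using Cauchy_convergent convergent_def by blast
  have "(\<lambda>n. g (X n)) \<longlonglongrightarrow> g u"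
    unfolding g_def by (intro tendsto_intros u f.tendsto)
  moreover have "(\<lambda>n. I + 1 / Suc n) \<longlonglongrightarrow> I + 0"
    by (intro tendsto_intros LIMSEQ_inverse_real_of_nat[unfolded inverse_eq_divide])
  ultimately have gu: "g u \<le> I"
    using X by (auto intro: LIMSEQ_le less_imp_le)
  have "f x = inner x u" for x
  proof -
    define d where "d = inner x u - f x"
    define s where "s = (norm x)\<^sup>2 + 1"
    have spos: "s > 0" by (simp add: s_def add_nonneg_pos)
    have *: "0 \<le> t\<^sup>2 * (norm x)\<^sup>2 + 2 * t * d" for t
    proof -
      have "g u \<le> g (u + t *\<^sub>R x)" using gu Ile order_trans by blast
      then show ?thesis
        unfolding g_def d_def power2_norm_eq_inner
        by (simp add: f.add f.scaleR inner_add_left inner_add_right inner_commute[of u x]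
            algebra_simps power2_eq_square)
    qed
    have "0 \<le> (- d / s)\<^sup>2 * (norm x)\<^sup>2 + 2 * (- d / s) * d" by (rule *)
    also have "\<dots> \<le> (d / s)\<^sup>2 * s + 2 * (- d / s) * d"
      by (intro add_right_mono) (simp add: s_def mult_left_mono)
    also have "\<dots> = - (d\<^sup>2 / s)"
      using spos by (simp add: power2_eq_square field_simps)
    finally have "d = 0" using spos by (simp add: field_simps)
    then show ?thesis by (simp add: d_def)
  qed
  then show ?thesis using that by blast
qed

lemma cadj_unique:
  fixes S S' :: "'b::complex_hilbert \<Rightarrow>\<^sub>L 'a::complex_hilbert"
  assumes "\<And>x y. cinner x (blinfun_apply S y) = cinner x (blinfun_apply S' y)"
  shows "S = S'"
proof (rule blinfun_eqI)
  fix y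
  have "inner x (S y - S' y) = 0" for x
    using arg_cong[OF assms[of x y], of Re] by (simp add: inner_diff_right flip: inner_eq_Re_cinner)
  then show "S y = S' y"
    by (metis eq_iff_diff_eq_0 inner_eq_zero_iff)
qed

lemma cinner_cadj:
  assumes "T \<in> bounded_ops UNIV"
  shows "cinner (blinfun_apply T x) y = cinner x (blinfun_apply (cadj T) y)"
proof -
  have "\<exists>u. \<forall>x. inner (T x) y = inner x u" for y
  proof -
    have "bounded_linear (\<lambda>x. inner (T x) y)"
      by (intro bounded_linear_compose[OF bounded_linear_inner_left] blinfun.bounded_linear_right)
    then show ?thesis by (rule riesz) blast
  qed
  then obtain S where S: "\<And>x y. inner (T x) y = inner x (S y)" by metis
  have eqI: "u = v" if "\<And>x :: 'a. inner x u = inner x v" for u v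
    using that by (metis eq_iff_diff_eq_0 inner_diff_right inner_eq_zero_iff)
  have bl: "bounded_linear S"
  proof (rule bounded_linear_intro)
    show "S (y + w) = S y + S w" for y w
      by (rule eqI) (simp add: inner_add_right flip: S)
    show "S (r *\<^sub>R y) = r *\<^sub>R S y" for r y
      by (rule eqI) (simp flip: S)
    show "norm (S y) \<le> norm y * norm T" for y
    proof (cases "S y = 0")
      case False
      have "(norm (S y))\<^sup>2 = inner (T (S y)) y" by (simp add: S power2_norm_eq_inner)
      also have "\<dots> \<le> norm (T (S y)) * norm y" by (rule norm_cauchy_schwarz)
      also have "\<dots> \<le> norm T * norm (S y) * norm y"
        by (intro mult_right_mono norm_blinfun) simp
      finally show ?thesis using False by (simp add: power2_eq_square mult.commute)
    qed simp
  qed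
  have TC: "T (c *\<^sub>C x) = c *\<^sub>C T x" for c x
    using assms by (simp add: bounded_ops_def)
  have SC: "S (\<i> *\<^sub>C y) = \<i> *\<^sub>C S y" for y
  proof (rule eqI)
    fix x
    have *: "inner a (\<i> *\<^sub>C b) = inner (- \<i> *\<^sub>C a) b" for a b :: "'c :: complex_hilbert"
      by (simp add: inner_eq_Re_cinner cinner_scaleC_right cinner_scaleC_left)
    show "inner x (S (\<i> *\<^sub>C y)) = inner x (\<i> *\<^sub>C S y)"
      unfolding S[symmetric] * TC[symmetric] by (simp add: S)
  qed
  have "\<forall>x y. cinner (T x) y = cinner x (Blinfun S y)"
    by (simp add: bounded_linear_Blinfun_apply[OF bl] cinner_eq_inner S flip: SC)
  then have "\<forall>x y. cinner (T x) y = cinner x (cadj T y)"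
    unfolding cadj_def
  proof (rule theI)
    fix S' assume "\<forall>x y. cinner (T x) y = cinner x (blinfun_apply S' y)"
    with \<open>\<forall>x y. cinner (T x) y = cinner x (Blinfun S y)\<close> show "S' = Blinfun S"
      by (intro cadj_unique) simp
  qed
  then show ?thesis by blast
qed


section \<open>Operator matrices\<close>

text \<open>
  Elements of the orthogonal sum of the spaces \<open>Y j\<close>, \<open>j \<in> J\<close> (\<open>J\<close> finite), are the functions
  \<open>y\<close> on \<open>J\<close> with \<open>y j \<in> Y j\<close>. The \<open>(j, q)\<close> entry of an operator matrix maps \<open>Y q\<close> to \<open>Y j\<close>.
\<close>

definition dsum :: "'i set \<Rightarrow> ('i \<Rightarrow> 'y::complex_hilbert set) \<Rightarrow> ('i \<Rightarrow> 'y) set" where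
  "dsum J Y = (\<Pi>\<^sub>E j\<in>J. Y j)"

definition dsum_inner :: "'i set \<Rightarrow> ('i \<Rightarrow> 'y::complex_hilbert) \<Rightarrow> ('i \<Rightarrow> 'y) \<Rightarrow> complex" where
  "dsum_inner J x y = (\<Sum>j\<in>J. cinner (x j) (y j))"

definition opmat_apply ::
  "'i set \<Rightarrow> ('i \<Rightarrow> 'i \<Rightarrow> 'y::complex_hilbert \<Rightarrow>\<^sub>L 'y) \<Rightarrow> ('i \<Rightarrow> 'y) \<Rightarrow> 'i \<Rightarrow> 'y" where
  "opmat_apply J T y = (\<lambda>j\<in>J. \<Sum>q\<in>J. blinfun_apply (T j q) (y q))"

definition opmat_selfadjoint ::
  "'i set \<Rightarrow> ('i \<Rightarrow> 'y::complex_hilbert set) \<Rightarrow> ('i \<Rightarrow> 'i \<Rightarrow> 'y \<Rightarrow>\<^sub>L 'y) \<Rightarrow> bool" where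
  "opmat_selfadjoint J Y T \<longleftrightarrow>
     (\<forall>x\<in>dsum J Y. opmat_apply J T x \<in> dsum J Y) \<and>
     (\<forall>x\<in>dsum J Y. \<forall>y\<in>dsum J Y.
        dsum_inner J (opmat_apply J T x) y = dsum_inner J x (opmat_apply J T y))"

definition opmat_ge ::
  "'i set \<Rightarrow> ('i \<Rightarrow> 'y::complex_hilbert set) \<Rightarrow>
     ('i \<Rightarrow> 'i \<Rightarrow> 'y \<Rightarrow>\<^sub>L 'y) \<Rightarrow> ('i \<Rightarrow> 'i \<Rightarrow> 'y \<Rightarrow>\<^sub>L 'y) \<Rightarrow> bool" where
  "opmat_ge J Y S T \<longleftrightarrow> opmat_selfadjoint J Y S \<and> opmat_selfadjoint J Y T \<and>
     (\<forall>x\<in>dsum J Y. Re (dsum_inner J (opmat_apply J S x) x)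
                 \<ge> Re (dsum_inner J (opmat_apply J T x) x))"


section \<open>Square-summable families\<close>

typedef (overloaded) ('i, 'a::complex_hilbert) ell2 = "{f :: 'i \<Rightarrow> 'a. (\<lambda>i. (norm (f i))\<^sup>2) summable_on UNIV}"
  morphisms coord Abs_ell2
  by (rule exI[of _ "\<lambda>_. 0"]) simp

setup_lifting type_definition_ell2

lemma coord_summable: "(\<lambda>i. (norm (coord f i))\<^sup>2) summable_on UNIV"
  using coord by blast

lemma ell2_eqI: "(\<And>i. coord f i = coord g i) \<Longrightarrow> f = g"
  by (simp add: coord_inject[symmetric] fun_eq_iff)

lemma cauchy_schwarz_cinner: "cmod (cinner x y) \<le> norm x * norm (y :: 'a :: complex_hilbert)"
proof (cases "cinner x y = 0")
  case False
  define c where "c = cnj (sgn (cinner x y))"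
  have "c * cinner x y = complex_of_real (cmod (cinner x y))"
    using False
    by (simp add: c_def sgn_eq complex_norm_square power2_eq_square flip: of_real_mult)
      (simp add: mult.commute flip: complex_norm_square, simp add: power2_eq_square)
  then have "cmod (cinner x y) = inner (c *\<^sub>C x) y"
    by (simp add: inner_eq_Re_cinner cinner_scaleC_left)
  also have "\<dots> \<le> norm (c *\<^sub>C x) * norm y" by (rule norm_cauchy_schwarz)
  also have "norm (c *\<^sub>C x) = norm x" using False by (simp add: norm_scaleC c_def norm_sgn)
  finally show ?thesis .
qed simp

lemma cinner_summable: "(\<lambda>i. cinner (coord f i) (coord g i)) summable_on UNIV"
proof (rule abs_summable_summable, rule summable_on_comparison_test)
  show "(\<lambda>i. (norm (coord f i))\<^sup>2 + (norm (coord g i))\<^sup>2) summable_on UNIV"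
    by (intro summable_on_add coord_summable)
  show "cmod (cinner (coord f i) (coord g i)) \<le> (norm (coord f i))\<^sup>2 + (norm (coord g i))\<^sup>2" for i
  proof -
    have "norm (coord f i) * norm (coord g i) \<le> (norm (coord f i))\<^sup>2 + (norm (coord g i))\<^sup>2"
      using sum_squares_bound[of "norm (coord f i)" "norm (coord g i)"]
        mult_nonneg_nonneg[OF norm_ge_zero[of "coord f i"] norm_ge_zero[of "coord g i"]]
      by linarith
    then show ?thesis using cauchy_schwarz_cinner order_trans by blast
  qed
qed auto

lemma inner_summable: "(\<lambda>i. inner (coord f i) (coord g i)) summable_on UNIV"
  unfolding inner_eq_Re_cinner by (intro summable_on_Re cinner_summable)

instantiation ell2 :: (type, complex_hilbert) real_inner
begin

lift_definition zero_ell2 :: "('a, 'b) ell2" is "\<lambda>_. 0" by simp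

lift_definition plus_ell2 :: "('a, 'b) ell2 \<Rightarrow> ('a, 'b) ell2 \<Rightarrow> ('a, 'b) ell2"
  is "\<lambda>f g i. f i + g i"
proof -
  fix f g :: "'a \<Rightarrow> 'b"
  assume *: "(\<lambda>i. (norm (f i))\<^sup>2) summable_on UNIV" "(\<lambda>i. (norm (g i))\<^sup>2) summable_on UNIV"
  have "(\<lambda>i. 2 * (norm (f i))\<^sup>2 + 2 * (norm (g i))\<^sup>2) summable_on UNIV"
    by (intro summable_on_add summable_on_cmult_right *)
  then show "(\<lambda>i. (norm (f i + g i))\<^sup>2) summable_on UNIV"
  proof (rule summable_on_comparison_test)
    show "(norm (f i + g i))\<^sup>2 \<le> 2 * (norm (f i))\<^sup>2 + 2 * (norm (g i))\<^sup>2" for i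
    proof -
      have "(norm (f i + g i))\<^sup>2 + (norm (f i - g i))\<^sup>2 = 2 * (norm (f i))\<^sup>2 + 2 * (norm (g i))\<^sup>2"
        by (simp add: power2_norm_eq_inner algebra_simps inner_commute)
      then show ?thesis by (smt (verit) zero_le_power2)
    qed
  qed auto
qed

lift_definition scaleR_ell2 :: "real \<Rightarrow> ('a, 'b) ell2 \<Rightarrow> ('a, 'b) ell2"
  is "\<lambda>r f i. r *\<^sub>R f i"
  by (simp add: power_mult_distrib summable_on_cmult_right)

lift_definition uminus_ell2 :: "('a, 'b) ell2 \<Rightarrow> ('a, 'b) ell2" is "\<lambda>f i. - f i"
  by simp

definition minus_ell2_def: "f - g = f + - (g :: ('a, 'b) ell2)"

definition inner_ell2_def:
  "inner f g = (\<Sum>\<^sub>\<infinity>i. inner (coord f i) (coord g i))" for f g :: "('a, 'b) ell2"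

definition norm_ell2_def: "norm f = sqrt (inner f f)" for f :: "('a, 'b) ell2"

definition dist_ell2_def: "dist f g = norm (f - g)" for f g :: "('a, 'b) ell2"

definition sgn_ell2_def: "sgn f = inverse (norm f) *\<^sub>R f" for f :: "('a, 'b) ell2"

definition uniformity_ell2_def:
  "(uniformity :: (('a, 'b) ell2 \<times> ('a, 'b) ell2) filter) =
     (INF e\<in>{0<..}. principal {(x, y). dist x y < e})"

definition open_ell2_def:
  "open (U :: ('a, 'b) ell2 set) \<longleftrightarrow>
     (\<forall>x\<in>U. eventually (\<lambda>(x', y). x' = x \<longrightarrow> y \<in> U) uniformity)"

lemma coord_zero: "coord (0 :: ('a, 'b) ell2) i = 0"
  by (simp add: zero_ell2.rep_eq)

lemma coord_add: "coord (f + g :: ('a, 'b) ell2) i = coord f i + coord g i"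
  by (simp add: plus_ell2.rep_eq)

lemma coord_uminus: "coord (- f :: ('a, 'b) ell2) i = - coord f i"
  by (simp add: uminus_ell2.rep_eq)

lemma coord_minus: "coord (f - g :: ('a, 'b) ell2) i = coord f i - coord g i"
  by (simp add: minus_ell2_def coord_add coord_uminus)

lemma coord_scaleR: "coord (r *\<^sub>R f :: ('a, 'b) ell2) i = r *\<^sub>R coord f i"
  by (simp add: scaleR_ell2.rep_eq)

lemma norm_ell2_power2: "(norm f)\<^sup>2 = (\<Sum>\<^sub>\<infinity>i. (norm (coord f i))\<^sup>2)" for f :: "('a, 'b) ell2"
  by (simp add: norm_ell2_def inner_ell2_def power2_norm_eq_inner infsum_nonneg)

lemma norm_ell2_nonneg: "norm f \<ge> 0" for f :: "('a, 'b) ell2"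
  by (simp add: norm_ell2_def inner_ell2_def infsum_nonneg)

lemma sum_coord_le: "finite A \<Longrightarrow> (\<Sum>i\<in>A. (norm (coord f i))\<^sup>2) \<le> (norm f)\<^sup>2"
  for f :: "('a, 'b) ell2"
  unfolding norm_ell2_power2 by (intro finite_sum_le_infsum coord_summable) auto

lemma norm_coord_le: "norm (coord f i) \<le> norm f" for f :: "('a, 'b) ell2"
  using sum_coord_le[of "{i}" f] norm_ell2_nonneg[of f] by (simp add: power2_le_iff_abs_le)

instance
proof
  fix x y w :: "('a, 'b) ell2" and r s :: real
  show "dist x y = norm (x - y)" by (rule dist_ell2_def)
  show "sgn x = inverse (norm x) *\<^sub>R x" by (rule sgn_ell2_def)
  show "(uniformity :: (('a, 'b) ell2 \<times> ('a, 'b) ell2) filter) =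
     (INF e\<in>{0<..}. principal {(x, y). dist x y < e})" by (rule uniformity_ell2_def)
  show "open U \<longleftrightarrow> (\<forall>x\<in>U. eventually (\<lambda>(x', y). x' = x \<longrightarrow> y \<in> U) uniformity)"
    for U :: "('a, 'b) ell2 set" by (rule open_ell2_def)
  show "x + y + w = x + (y + w)" "x + y = y + x" "0 + x = x" "- x + x = 0" "x - y = x + - y"
    by (auto intro!: ell2_eqI simp: coord_add coord_zero coord_uminus coord_minus)
  show "r *\<^sub>R (x + y) = r *\<^sub>R x + r *\<^sub>R y" "(r + s) *\<^sub>R x = r *\<^sub>R x + s *\<^sub>R x"
    "r *\<^sub>R s *\<^sub>R x = (r * s) *\<^sub>R x" "1 *\<^sub>R x = x"
    by (auto intro!: ell2_eqI simp: coord_add coord_scaleR algebra_simps)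
  show "inner x y = inner y x"
    unfolding inner_ell2_def by (intro infsum_cong inner_commute)
  show "inner (x + y) w = inner x w + inner y w"
    unfolding inner_ell2_def coord_add inner_add_left
    by (intro infsum_add inner_summable)
  show "inner (r *\<^sub>R x) y = r * inner x y"
    unfolding inner_ell2_def coord_scaleR inner_scaleR_left by (rule infsum_cmult_right')
  show "0 \<le> inner x x"
    unfolding inner_ell2_def by (intro infsum_nonneg) simp
  show "inner x x = 0 \<longleftrightarrow> x = 0"
  proof
    assume "inner x x = 0"
    then have "norm x = 0" by (simp add: norm_ell2_def)
    then show "x = 0"
      using norm_coord_le[of x] by (intro ell2_eqI) (simp add: coord_zero)
  qed (simp add: inner_ell2_def coord_zero)
  show "norm x = sqrt (inner x x)" by (rule norm_ell2_def)
qed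

end

lemma ell2_Cauchy_convergent:
  fixes X :: "nat \<Rightarrow> ('i, 'a::complex_hilbert) ell2"
  assumes X: "\<And>e. e > 0 \<Longrightarrow> \<exists>N. \<forall>m\<ge>N. \<forall>n\<ge>N. norm (X m - X n) < e"
  shows "\<exists>L. \<forall>e>0. \<exists>N. \<forall>n\<ge>N. norm (X n - L) < e"
proof -
  have "Cauchy (\<lambda>n. coord (X n) i)" for i
  proof (rule metric_CauchyI)
    fix e :: real assume "e > 0"
    then obtain N where N: "\<forall>m\<ge>N. \<forall>n\<ge>N. norm (X m - X n) < e" using X by blast
    have le: "dist (coord (X m) i) (coord (X n) i) \<le> norm (X m - X n)" for m n
      unfolding dist_norm coord_minus[symmetric] by (rule norm_coord_le)
    show "\<exists>M. \<forall>m\<ge>M. \<forall>n\<ge>M. dist (coord (X m) i) (coord (X n) i) < e"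
    proof (intro exI[of _ N] allI impI)
      fix m n assume "m \<ge> N" "n \<ge> N"
      then have "norm (X m - X n) < e" using N by simp
      with le show "dist (coord (X m) i) (coord (X n) i) < e" by (rule le_less_trans)
    qed
  qed
  then have conv: "convergent (\<lambda>n. coord (X n) i)" for i
    by (rule Cauchy_convergent)
  define l where "l i = lim (\<lambda>n. coord (X n) i)" for i
  have l: "(\<lambda>n. coord (X n) i) \<longlonglongrightarrow> l i" for i
    unfolding l_def using conv by (simp add: convergent_LIMSEQ_iff)
  have fin: "(\<Sum>i\<in>A. (norm (coord (X m) i - l i))\<^sup>2) \<le> e\<^sup>2"
    if "finite A" and N: "\<And>n. n \<ge> N \<Longrightarrow> norm (X m - X n) < e" for A m N e
  proof (rule LIMSEQ_le_const2)
    show "(\<lambda>n. \<Sum>i\<in>A. (norm (coord (X m) i - coord (X n) i))\<^sup>2)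
        \<longlonglongrightarrow> (\<Sum>i\<in>A. (norm (coord (X m) i - l i))\<^sup>2)"
      by (intro tendsto_intros l)
    have "(\<Sum>i\<in>A. (norm (coord (X m) i - coord (X n) i))\<^sup>2) \<le> e\<^sup>2" if "n \<ge> N" for n
    proof -
      have "(\<Sum>i\<in>A. (norm (coord (X m) i - coord (X n) i))\<^sup>2) \<le> (norm (X m - X n))\<^sup>2"
        unfolding coord_minus[symmetric] by (rule sum_coord_le) fact
      also have "\<dots> \<le> e\<^sup>2"
        using N[OF that] norm_ell2_nonneg by (intro power_mono) auto
      finally show ?thesis .
    qed
    then show "\<exists>N. \<forall>n\<ge>N. (\<Sum>i\<in>A. (norm (coord (X m) i - coord (X n) i))\<^sup>2) \<le> e\<^sup>2" by blast
  qed
  have summ: "(\<lambda>i. (norm (coord (X m) i - l i))\<^sup>2) summable_on UNIV"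
    if N: "\<And>n. n \<ge> N \<Longrightarrow> norm (X m - X n) < e" for m N e
  proof (rule nonneg_bdd_above_summable_on)
    show "bdd_above (sum (\<lambda>i. (norm (coord (X m) i - l i))\<^sup>2) ` {F. F \<subseteq> UNIV \<and> finite F})"
    proof (rule bdd_aboveI2)
      fix F :: "'i set" assume "F \<in> {F. F \<subseteq> UNIV \<and> finite F}"
      then have "finite F" by blast
      then show "(\<Sum>i\<in>F. (norm (coord (X m) i - l i))\<^sup>2) \<le> e\<^sup>2"
        by (rule fin) (rule N)
    qed
  qed simp
  obtain N1 where N1: "\<forall>m\<ge>N1. \<forall>n\<ge>N1. norm (X m - X n) < 1"
    using X[OF zero_less_one] by blast
  define D where "D = Abs_ell2 (\<lambda>i. coord (X N1) i - l i)"
  have D: "coord D i = coord (X N1) i - l i" for i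
  proof -
    have "(\<lambda>i. (norm (coord (X N1) i - l i))\<^sup>2) summable_on UNIV"
      by (rule summ[of N1 N1 1]) (use N1 in blast)
    then show ?thesis by (simp add: D_def Abs_ell2_inverse)
  qed
  define L where "L = X N1 - D"
  have L: "coord L i = l i" for i by (simp add: L_def coord_minus D)
  show ?thesis
  proof (intro exI[of _ L] allI impI)
    fix e :: real assume e: "e > 0"
    then obtain N where N: "\<forall>m\<ge>N. \<forall>n\<ge>N. norm (X m - X n) < e / 2"
      using X[OF half_gt_zero[OF e]] by blast
    have "norm (X n - L) < e" if "n \<ge> N" for n
    proof -
      have Nn: "norm (X n - X n') < e / 2" if "n' \<ge> N" for n'
        using N that \<open>n \<ge> N\<close> by blast
      have "(norm (X n - L))\<^sup>2 \<le> (e / 2)\<^sup>2"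
        unfolding norm_ell2_power2 coord_minus L
      proof (rule infsum_le_finite_sums)
        show "(\<lambda>i. (norm (coord (X n) i - l i))\<^sup>2) summable_on UNIV"
          by (rule summ) (rule Nn)
        show "(\<Sum>i\<in>F. (norm (coord (X n) i - l i))\<^sup>2) \<le> (e / 2)\<^sup>2" if "finite F" for F
          using that by (rule fin) (rule Nn)
      qed
      then have "norm (X n - L) \<le> e / 2"
        by (rule power2_le_imp_le) (use e in simp)
      then show ?thesis using e by simp
    qed
    then show "\<exists>N. \<forall>n\<ge>N. norm (X n - L) < e" by blast
  qed
qed

instance ell2 :: (type, complex_hilbert) complete_space
proof
  fix X :: "nat \<Rightarrow> ('a, 'b) ell2"
  assume "Cauchy X"
  then have "\<exists>N. \<forall>m\<ge>N. \<forall>n\<ge>N. norm (X m - X n) < e" if "e > 0" for e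
    using that unfolding Cauchy_def dist_norm by blast
  then obtain L where "\<forall>e>0. \<exists>N. \<forall>n\<ge>N. norm (X n - L) < e"
    using ell2_Cauchy_convergent by blast
  then show "convergent X"
    unfolding convergent_def lim_sequentially dist_norm by blast
qed

instantiation ell2 :: (type, complex_hilbert) complex_hilbert
begin

lift_definition scaleC_ell2 :: "complex \<Rightarrow> ('a, 'b) ell2 \<Rightarrow> ('a, 'b) ell2"
  is "\<lambda>c f i. c *\<^sub>C f i"
  by (simp add: norm_scaleC power_mult_distrib summable_on_cmult_right)

definition cinner_ell2_def:
  "cinner f g = (\<Sum>\<^sub>\<infinity>i. cinner (coord f i) (coord g i))" for f g :: "('a, 'b) ell2"

lemma coord_scaleC: "coord (c *\<^sub>C f :: ('a, 'b) ell2) i = c *\<^sub>C coord f i"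
  by (simp add: scaleC_ell2.rep_eq)

instance
proof
  fix x y w :: "('a, 'b) ell2" and a b :: complex and r :: real
  show "a *\<^sub>C (x + y) = a *\<^sub>C x + a *\<^sub>C y" "(a + b) *\<^sub>C x = a *\<^sub>C x + b *\<^sub>C x"
    "a *\<^sub>C (b *\<^sub>C x) = (a * b) *\<^sub>C x"
    by (auto intro!: ell2_eqI
        simp: coord_add coord_scaleC scaleC_add_left scaleC_add_right scaleC_scaleC)
  show "r *\<^sub>R x = complex_of_real r *\<^sub>C x" by (intro ell2_eqI) (simp add: coord_scaleR coord_scaleC scaleR_scaleC)
  show "cinner x y = cnj (cinner y x)"
    unfolding cinner_ell2_def infsum_cnj[symmetric] by (intro infsum_cong cinner_commute)
  show "cinner (x + y) w = cinner x w + cinner y w"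
    unfolding cinner_ell2_def coord_add cinner_add_left
    by (intro infsum_add cinner_summable)
  show "cinner (a *\<^sub>C x) y = a * cinner x y"
    unfolding cinner_ell2_def coord_scaleC cinner_scaleC_left by (rule infsum_cmult_right')
  show "inner x y = Re (cinner x y)"
    unfolding inner_ell2_def cinner_ell2_def inner_eq_Re_cinner
    by (rule infsum_Re) (rule cinner_summable)
qed

end

lemma bounded_linear_coord: "bounded_linear (\<lambda>f :: ('i, 'a::complex_hilbert) ell2. coord f i)"
  by (rule bounded_linear_intro[where K = 1])
    (simp_all add: coord_add coord_scaleR norm_coord_le)

lift_definition single :: "'i \<Rightarrow> 'a \<Rightarrow> ('i, 'a::complex_hilbert) ell2"
  is "\<lambda>i a j. if j = i then a else 0"
  by (rule finite_nonzero_values_imp_summable_on) (auto intro: finite_subset[of _ "{i}" for i])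

text \<open>
  The space \<open>('i, 'a) ell2\<close> is the Hilbert space tensor product of \<open>('i, complex) ell2\<close> and \<open>'a\<close>:
  the elementary tensors \<open>f \<otimes> a\<close> below are bilinear, have the right inner products
  (\<open>cinner_tensor\<close>) and span a dense subspace (\<open>tensor_total\<close>).
\<close>

lift_definition tensor :: "('i, complex) ell2 \<Rightarrow> 'a \<Rightarrow> ('i, 'a::complex_hilbert) ell2"
    (infixr "\<otimes>\<^sub>2" 70)
  is "\<lambda>f a i. f i *\<^sub>C a"
  by (simp add: norm_scaleC power_mult_distrib summable_on_cmult_left)

lemma coord_tensor: "coord (f \<otimes>\<^sub>2 a) i = coord f i *\<^sub>C a"
  by (simp add: tensor.rep_eq)

lemma cinner_tensor: "cinner (f \<otimes>\<^sub>2 a) (g \<otimes>\<^sub>2 b) = cinner f g * cinner a b"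
  unfolding cinner_ell2_def infsum_cmult_left'[symmetric]
  by (intro infsum_cong)
    (simp add: coord_tensor cinner_scaleC_left cinner_scaleC_right cinner_complex_def)

lemma single_tensor: "single i 1 \<otimes>\<^sub>2 a = single i a"
  by (rule ell2_eqI) (auto simp: coord_tensor single.rep_eq )

lemma coord_sum: "coord (\<Sum>i\<in>A. f i) j = (\<Sum>i\<in>A. coord (f i :: ('i, 'a::complex_hilbert) ell2) j)"
  by (rule linear_sum[OF bounded_linear.linear[OF bounded_linear_coord]])

lemma tensor_total:
  "closure (span (range (\<lambda>(f, a). f \<otimes>\<^sub>2 a))) = (UNIV :: ('i, 'a::complex_hilbert) ell2 set)"
proof (intro equalityI subsetI UNIV_I)
  fix x :: "('i, 'a) ell2"
  let ?S = "span (range (\<lambda>(f, a). f \<otimes>\<^sub>2 a)) :: ('i, 'a) ell2 set"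
  show "x \<in> closure ?S"
    unfolding closure_approachable
  proof (intro allI impI)
    fix e :: real assume e: "e > 0"
    obtain A where A: "finite A"
      "dist (\<Sum>i\<in>A. (norm (coord x i))\<^sup>2) (\<Sum>\<^sub>\<infinity>i. (norm (coord x i))\<^sup>2) \<le> e\<^sup>2 / 2"
      using infsum_finite_approximation[OF coord_summable[of x], of "e\<^sup>2 / 2"] e by auto
    define y where "y = (\<Sum>i\<in>A. single i 1 \<otimes>\<^sub>2 coord x i)"
    have "y \<in> ?S"
      unfolding y_def by (intro span_sum span_base) auto
    have y: "coord y i = (if i \<in> A then coord x i else 0)" for i
      unfolding y_def coord_sum single_tensor using A(1)
      by (simp add: single.rep_eq sum.delta)
    have "(norm (y - x))\<^sup>2 = (\<Sum>\<^sub>\<infinity>i\<in>-A. (norm (coord x i))\<^sup>2)"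
      unfolding norm_ell2_power2 coord_minus y by (intro infsum_cong_neutral) auto
    moreover have "(\<Sum>\<^sub>\<infinity>i\<in>-A. (norm (coord x i))\<^sup>2) + (\<Sum>i\<in>A. (norm (coord x i))\<^sup>2) = (\<Sum>\<^sub>\<infinity>i\<in>-A \<union> A. (norm (coord x i))\<^sup>2)"
      using A(1) coord_summable[of x]
      by (subst infsum_Un_disjoint) (auto intro: summable_on_subset_banach)
    ultimately have "(norm (y - x))\<^sup>2 < e\<^sup>2"
      using A(2) zero_less_power[OF e, of 2] unfolding dist_real_def Compl_partition2 by linarith
    then have "dist y x < e"
      using e by (simp add: dist_norm power2_less_imp_less)
    with \<open>y \<in> ?S\<close> show "\<exists>y\<in>?S. dist y x < e" by blast
  qed
qed


section \<open>The full Fock space\<close>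

text \<open>
  The free monoid on \<open>n\<close> generators is the type \<open>'n list\<close> with \<open>n = CARD('n)\<close> and concatenation.
  The vectors \<open>e_\<alpha>\<close> form an orthonormal basis of the full Fock space, those with
  \<open>length \<alpha> = p\<close> being a basis of the \<open>p\<close>-th tensor power; so the Fock space is
  \<open>('n list, complex) ell2\<close> with \<open>e_\<alpha> = single \<alpha> 1\<close>, and its tensor product with \<open>'k\<close> is
  \<open>('n list, 'k) ell2\<close>.
\<close>

type_synonym 'n fock = "('n list, complex) ell2"

definition fock_basis :: "'n list \<Rightarrow> 'n fock" where
  "fock_basis \<alpha> = single \<alpha> 1"

text \<open>
  Left creation operators: \<open>creation i\<close> is \<open>S_i\<close> on the Fock space itself (\<open>'a = complex\<close>), and
  \<open>S_i \<otimes> I\<close> on its tensor product with \<open>'a\<close>; see \<open>creation_tensor\<close>.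
\<close>

lift_definition creation :: "'n \<Rightarrow> ('n list, 'a::complex_hilbert) ell2 \<Rightarrow> ('n list, 'a) ell2"
  is "\<lambda>i f \<alpha>. case \<alpha> of [] \<Rightarrow> 0 | j # \<beta> \<Rightarrow> if j = i then f \<beta> else 0"
proof -
  fix i :: 'n and f :: "'n list \<Rightarrow> 'a"
  assume f: "(\<lambda>\<alpha>. (norm (f \<alpha>))\<^sup>2) summable_on UNIV"
  let ?g = "\<lambda>\<alpha>. (norm (case \<alpha> of [] \<Rightarrow> 0 | j # \<beta> \<Rightarrow> if j = i then f \<beta> else 0))\<^sup>2"
  have "?g summable_on range (Cons i)"
    using f by (subst summable_on_reindex) (auto simp: o_def)
  moreover have "?g summable_on range (Cons i) \<longleftrightarrow> ?g summable_on UNIV"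
  proof (rule summable_on_cong_neutral)
    show "?g \<alpha> = 0" if "\<alpha> \<in> UNIV - range (Cons i)" for \<alpha>
      using that by (cases \<alpha>) auto
  qed auto
  ultimately show "?g summable_on UNIV" by blast
qed

definition creation_word :: "'n list \<Rightarrow> ('n list, 'a::complex_hilbert) ell2 \<Rightarrow> ('n list, 'a) ell2" where
  "creation_word \<alpha> = foldr creation \<alpha>"

lemma creation_tensor: "creation i (f \<otimes>\<^sub>2 a) = creation i f \<otimes>\<^sub>2 a"
proof (rule ell2_eqI)
  show "coord (creation i (f \<otimes>\<^sub>2 a)) \<beta> = coord (creation i f \<otimes>\<^sub>2 a) \<beta>" for \<beta>
    by (cases \<beta>) (simp_all add: creation.rep_eq coord_tensor)
qed

lemma creation_basis: "creation i (fock_basis \<alpha>) = fock_basis (i # \<alpha>)"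
proof (rule ell2_eqI)
  show "coord (creation i (fock_basis \<alpha>)) \<beta> = coord (fock_basis (i # \<alpha>)) \<beta>" for \<beta>
    by (cases \<beta>) (simp_all add: fock_basis_def creation.rep_eq single.rep_eq)
qed

lemma coord_creation_word:
  "coord (creation_word \<alpha> f) \<beta> =
     (if take (length \<alpha>) \<beta> = \<alpha> then coord f (drop (length \<alpha>) \<beta>) else 0)"
proof (induction \<alpha> arbitrary: \<beta>)
  case Nil
  then show ?case by (simp add: creation_word_def)
next
  case (Cons i \<alpha>)
  have "creation_word (i # \<alpha>) f = creation i (creation_word \<alpha> f)"
    by (simp add: creation_word_def)
  then show ?case
    by (cases \<beta>) (simp_all add: creation.rep_eq Cons.IH)
qed

lemma norm_creation_word: "norm (creation_word \<alpha> f) = norm f"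
proof -
  have inj: "inj_on ((@) \<alpha>) UNIV" by (simp add: inj_on_def)
  have "(norm (creation_word \<alpha> f))\<^sup>2 = (\<Sum>\<^sub>\<infinity>\<beta>\<in>range ((@) \<alpha>). (norm (coord (creation_word \<alpha> f) \<beta>))\<^sup>2)"
    unfolding norm_ell2_power2
  proof (rule infsum_cong_neutral)
    show "(norm (coord (creation_word \<alpha> f) \<beta>))\<^sup>2 = 0" if "\<beta> \<in> UNIV - range ((@) \<alpha>)" for \<beta>
      using that by (auto simp: coord_creation_word) (metis append_take_drop_id rangeI)
  qed auto
  also have "\<dots> = (norm f)\<^sup>2"
    unfolding infsum_reindex[OF inj] norm_ell2_power2 by (simp add: o_def coord_creation_word)
  finally show ?thesis by simp
qed

text \<open>The operator \<open>A_(\<alpha>)\<close> in \<open>\<theta> h = \<Sum>\<alpha>. e_\<alpha> \<otimes> A_(\<alpha>) h\<close>.\<close>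

lift_definition op_coeff ::
  "('h::complex_hilbert \<Rightarrow>\<^sub>L ('i, 'k::complex_hilbert) ell2) \<Rightarrow> 'i \<Rightarrow> 'h \<Rightarrow>\<^sub>L 'k"
  is "\<lambda>\<theta> i h. coord (\<theta> h) i"
  by (rule bounded_linear_compose[OF bounded_linear_coord])

definition monomial_at :: "complex ^ 'n \<Rightarrow> 'n list \<Rightarrow> complex" where
  "monomial_at z \<alpha> = (\<Prod>i\<leftarrow>\<alpha>. z $ i)"

text \<open>The limit of the outer series is taken in the operator norm.\<close>

definition op_eval ::
  "('h::complex_hilbert \<Rightarrow>\<^sub>L ('n::finite list, 'k::complex_hilbert) ell2) \<Rightarrow> complex ^ 'n \<Rightarrow> 'h \<Rightarrow>\<^sub>L 'k"
  where
  "op_eval \<theta> z = (\<Sum>p. \<Sum>\<alpha> | length \<alpha> = p. monomial_at z \<alpha> *\<^sub>C op_coeff \<theta> \<alpha>)"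

definition fock_poly :: "nat \<Rightarrow> ('n::finite list, 'h::complex_hilbert) ell2 set" where
  "fock_poly k = {q. \<forall>\<alpha>. length \<alpha> > k \<longrightarrow> coord q \<alpha> = 0}"

definition mult_op ::
  "('h::complex_hilbert \<Rightarrow>\<^sub>L ('n::finite list, 'k::complex_hilbert) ell2) \<Rightarrow>
     ('n list, 'h) ell2 \<Rightarrow> ('n list, 'k) ell2" where
  "mult_op \<theta> q = (\<Sum>\<alpha> | coord q \<alpha> \<noteq> 0. creation_word \<alpha> (blinfun_apply \<theta> (coord q \<alpha>)))"

definition mult_op_norm ::
  "nat \<Rightarrow> ('h::complex_hilbert \<Rightarrow>\<^sub>L ('n::finite list, 'k::complex_hilbert) ell2) \<Rightarrow> real" where
  "mult_op_norm k \<theta> = (SUP q \<in> {q \<in> fock_poly k. norm q \<le> 1}. norm (mult_op \<theta> q))"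

lemma finite_words: "finite {\<alpha> :: 'n::finite list. length \<alpha> \<le> k}"
  using finite_lists_length_le[of "UNIV :: 'n set" k] by simp

lemma creation_word_zero [simp]: "creation_word \<alpha> 0 = 0"
  by (rule ell2_eqI) (simp add: coord_creation_word coord_zero)

lemma creation_word_add: "creation_word \<alpha> (f + g) = creation_word \<alpha> f + creation_word \<alpha> g"
  by (rule ell2_eqI) (simp add: coord_creation_word coord_add)

lemma creation_word_scaleC: "creation_word \<alpha> (c *\<^sub>C f) = c *\<^sub>C creation_word \<alpha> f"
  by (rule ell2_eqI) (simp add: coord_creation_word coord_scaleC)

lemma mult_op_altdef:
  assumes "q \<in> fock_poly k"
  shows "mult_op \<theta> q = (\<Sum>\<alpha> | length \<alpha> \<le> k. creation_word \<alpha> (blinfun_apply \<theta> (coord q \<alpha>)))"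
  unfolding mult_op_def using assms
  by (intro sum.mono_neutral_left finite_words) (auto simp: fock_poly_def blinfun.zero_right not_le[symmetric])

text \<open>
  \<open>mult_op \<theta>\<close> is the linear map on polynomials determined by
  \<open>e_\<alpha> \<otimes> h \<mapsto> (S_\<alpha> \<otimes> I) \<theta> h\<close>, and it is bounded on polynomials of degree at most \<open>k\<close>.
\<close>

lemma mult_op_tensor:
  "mult_op \<theta> (fock_basis \<alpha> \<otimes>\<^sub>2 h) = creation_word \<alpha> (blinfun_apply \<theta> h)"
proof -
  have "fock_basis \<alpha> \<otimes>\<^sub>2 h \<in> fock_poly (length \<alpha>)"
    by (auto simp: fock_poly_def fock_basis_def single_tensor single.rep_eq)
  then have "mult_op \<theta> (fock_basis \<alpha> \<otimes>\<^sub>2 h) =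
      (\<Sum>\<beta> | length \<beta> \<le> length \<alpha>. if \<beta> = \<alpha> then creation_word \<alpha> (blinfun_apply \<theta> h) else 0)"
    by (subst mult_op_altdef, assumption, intro sum.cong refl)
      (auto simp: fock_basis_def single_tensor single.rep_eq blinfun.zero_right)
  then show ?thesis by (simp add: finite_words)
qed

lemma mult_op_add:
  assumes "q \<in> fock_poly k" "r \<in> fock_poly k"
  shows "mult_op \<theta> (q + r) = mult_op \<theta> q + mult_op \<theta> r"
proof -
  have "q + r \<in> fock_poly k" using assms by (simp add: fock_poly_def coord_add)
  then show ?thesis
    by (simp add: mult_op_altdef[of _ k] assms coord_add blinfun.add_right creation_word_add
        sum.distrib)
qed

lemma mult_op_scaleC:
  assumes "\<theta> \<in> bounded_ops UNIV" "q \<in> fock_poly k"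
  shows "mult_op \<theta> (c *\<^sub>C q) = c *\<^sub>C mult_op \<theta> q"
proof -
  have "c *\<^sub>C q \<in> fock_poly k" using assms(2) by (simp add: fock_poly_def coord_scaleC)
  moreover have "blinfun_apply \<theta> (c *\<^sub>C x) = c *\<^sub>C blinfun_apply \<theta> x" for x
    using assms(1) by (simp add: bounded_ops_def)
  ultimately show ?thesis
    by (simp add: mult_op_altdef[of _ k] assms(2) coord_scaleC creation_word_scaleC
        linear_sum[OF bounded_linear.linear[OF bounded_linear_scaleC]])
qed

lemma mult_op_bounded:
  fixes \<theta> :: "'h::complex_hilbert \<Rightarrow>\<^sub>L ('n::finite list, 'k::complex_hilbert) ell2"
  shows
  "bdd_above ((\<lambda>q. norm (mult_op \<theta> q)) ` {q \<in> fock_poly k. norm q \<le> 1})"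
proof (intro bdd_aboveI2)
  fix q :: "('n list, 'h) ell2"
  assume q: "q \<in> {q \<in> fock_poly k. norm q \<le> 1}"
  then have "norm (mult_op \<theta> q) =
      norm (\<Sum>\<alpha> | length \<alpha> \<le> k. creation_word \<alpha> (blinfun_apply \<theta> (coord q \<alpha>)))"
    by (simp add: mult_op_altdef[of _ k])
  also have "\<dots> \<le> (\<Sum>\<alpha> :: 'n list | length \<alpha> \<le> k. norm \<theta> * 1)"
  proof (intro order_trans[OF norm_sum sum_mono])
    fix \<alpha>
    have "norm (coord q \<alpha>) \<le> 1" using q norm_coord_le[of q \<alpha>] by simp
    then have "norm \<theta> * norm (coord q \<alpha>) \<le> norm \<theta> * 1" by (intro mult_left_mono) auto
    then show "norm (creation_word \<alpha> (blinfun_apply \<theta> (coord q \<alpha>))) \<le> norm \<theta> * 1"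
      unfolding norm_creation_word using norm_blinfun order_trans by blast
  qed
  finally show "norm (mult_op \<theta> q) \<le> (\<Sum>\<alpha> :: 'n list | length \<alpha> \<le> k. norm \<theta> * 1)" .
qed

end

theory Submission
  imports Defs
begin

text \<open>
  With \<open>K_z\<close> the vector whose coefficient at \<open>e_\<alpha>\<close> is the conjugate of \<open>z_\<alpha>\<close>, and \<open>P\<close> the projection
  onto polynomials of degree at most \<open>k\<close>, put \<open>v y = (\<Sum>j. K_(z j) \<otimes> B_j* y_j)\<close> and
  \<open>w y = (\<Sum>j. P K_(z j) \<otimes> C_j* y_j)\<close>. The two operator matrices are the Gram matrices of \<open>v\<close> and \<open>w\<close>,
  so the matrix inequality says that \<open>norm (w y) \<le> norm (v y)\<close> for all \<open>y\<close>. If \<open>\<theta>\<close> solves the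
  interpolation problem, then \<open>(M_\<theta> P)* v y = w y\<close>, which gives this inequality.

  Conversely, the inequality yields a contraction \<open>\<Gamma>\<close> with \<open>\<Gamma> (v y) = w y\<close> that vanishes on the orthogonal
  complement of the range \<open>W\<close> of \<open>v\<close>. Its adjoint \<open>T\<close> satisfies \<open>T S_i q = Q S_i T q\<close> on polynomials \<open>q\<close> of
  degree less than \<open>k\<close>, where \<open>Q\<close> is the projection onto the closure of \<open>W\<close>, a space invariant under all \<open>S_i*\<close>.
  Let \<open>D\<close> satisfy \<open>D* D = 1 - T* T\<close>. The relation
  \<open>D (\<Sum>i. S_i q_i) \<mapsto> ((1 - Q) (\<Sum>i. S_i T q_i), (D q_i)_i)\<close> is isometric, hence extends to a contraction
  \<open>\<omega> = (\<omega>_0, \<omega>_1, ..., \<omega>_n)\<close>. The solution \<open>R\<close> of \<open>R x = \<omega>_0 x + (\<Sum>i. S_i R \<omega>_i x)\<close> is a contraction into the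
  complement of \<open>W\<close>, because the range of \<open>\<omega>_0\<close> is a wandering subspace there. Then \<open>T + R D\<close> is a contraction that
  commutes with the \<open>S_i\<close> on polynomials of degree less than \<open>k\<close>, so it is \<open>M_\<theta>\<close> for its restriction \<open>\<theta>\<close> to the
  constants.
\<close>

section \<open>Complex Hilbert spaces\<close>

instance complex_hilbert \<subseteq> banach ..

lemma bounded_ops_scaleC: "T \<in> bounded_ops Y \<Longrightarrow> T (c *\<^sub>C x) = c *\<^sub>C T x"
  by (simp add: bounded_ops_def)

lemma bounded_ops_UNIV: "T \<in> bounded_ops Y \<Longrightarrow> T \<in> bounded_ops UNIV"
  by (auto simp: bounded_ops_def)

lemma bounded_ops_range: "T \<in> bounded_ops Y \<Longrightarrow> T x \<in> Y"
  by (auto simp: bounded_ops_def)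

lemma cinner_zero_left [simp]: "cinner 0 (y :: 'a::complex_hilbert) = 0"
  using cinner_add_left[of 0 0 y] by simp

lemma cinner_zero_right [simp]: "cinner (y :: 'a::complex_hilbert) 0 = 0"
  using cinner_add_right[of y 0 0] by simp

lemma scaleC_minus1: "(- 1) *\<^sub>C x = - (x :: 'a::complex_hilbert)"
  using scaleR_scaleC[of "- 1" x] by simp

lemma cinner_minus_left: "cinner (- x) (y :: 'a::complex_hilbert) = - cinner x y"
  using cinner_scaleC_left[of "- 1" x y] by (simp add: scaleC_minus1)

lemma cinner_minus_right: "cinner x (- y :: 'a::complex_hilbert) = - cinner x y"
  using cinner_scaleC_right[of x "- 1" y] by (simp add: scaleC_minus1)

lemma cinner_diff_left: "cinner (x - x') (y :: 'a::complex_hilbert) = cinner x y - cinner x' y"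
  using cinner_add_left[of x "- x'" y] by (simp add: cinner_minus_left)

lemma cinner_diff_right: "cinner x (y - y' :: 'a::complex_hilbert) = cinner x y - cinner x y'"
  using cinner_add_right[of x y "- y'"] by (simp add: cinner_minus_right)

lemma cinner_sum_left: "cinner (\<Sum>i\<in>I. f i) (y :: 'a::complex_hilbert) = (\<Sum>i\<in>I. cinner (f i) y)"
  by (induction I rule: infinite_finite_induct) (simp_all add: cinner_add_left)

lemma cinner_sum_right: "cinner (y :: 'a::complex_hilbert) (\<Sum>i\<in>I. f i) = (\<Sum>i\<in>I. cinner y (f i))"
  by (induction I rule: infinite_finite_induct) (simp_all add: cinner_add_right)

lemma scaleC_sum_right: "c *\<^sub>C (\<Sum>i\<in>I. f i) = (\<Sum>i\<in>I. c *\<^sub>C (f i :: 'a::complex_hilbert))"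
  by (rule linear_sum[OF bounded_linear.linear[OF bounded_linear_scaleC]])

lemma scaleC_diff_right: "c *\<^sub>C (x - y) = c *\<^sub>C x - c *\<^sub>C (y :: 'a::complex_hilbert)"
  by (rule linear_diff[OF bounded_linear.linear[OF bounded_linear_scaleC]])

lemma cinner_zero_commute: "cinner x y = 0 \<Longrightarrow> cinner y (x :: 'a::complex_hilbert) = 0"
  using cinner_commute[of y x] by simp

lemma bounded_linear_cinner_left: "bounded_linear (\<lambda>x. cinner x (y :: 'a::complex_hilbert))"
  by (rule bounded_linear_intro[where K = "norm y"])
    (simp_all add: cinner_add_left scaleR_scaleC cinner_scaleC_left scaleC_complex_def
      cauchy_schwarz_cinner)

lemma bounded_linear_cinner_right: "bounded_linear (\<lambda>x. cinner (y :: 'a::complex_hilbert) x)"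
  by (rule bounded_linear_intro[where K = "norm y"])
    (simp_all add: cinner_add_right scaleR_scaleC cinner_scaleC_right scaleC_complex_def
      cauchy_schwarz_cinner mult.commute[of "norm (_ :: 'a)" "norm y"])

lemma pythagoras:
  assumes "cinner x (y :: 'a::complex_hilbert) = 0"
  shows "(norm (x + y))\<^sup>2 = (norm x)\<^sup>2 + (norm y)\<^sup>2"
proof -
  have "inner x y = 0" using assms by (simp add: inner_eq_Re_cinner)
  then show ?thesis by (simp add: power2_norm_eq_inner algebra_simps inner_commute)
qed

section \<open>Adjoints, and the orthogonal sum of two Hilbert spaces\<close>

lemma cadj_bounded_ops:
  fixes T :: "'a::complex_hilbert \<Rightarrow>\<^sub>L 'b::complex_hilbert"
  assumes "T \<in> bounded_ops UNIV"
  shows "cadj T \<in> bounded_ops UNIV"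
proof -
  have "cadj T (c *\<^sub>C y) = c *\<^sub>C cadj T y" for c y
  proof -
    have "cinner x (cadj T (c *\<^sub>C y) - c *\<^sub>C cadj T y) = 0" for x
      by (simp add: cinner_diff_right cinner_scaleC_right flip: cinner_cadj[OF assms])
    from this[of "cadj T (c *\<^sub>C y) - c *\<^sub>C cadj T y"] show ?thesis
      by (simp add: cinner_self)
  qed
  then show ?thesis by (auto simp: bounded_ops_def)
qed

text \<open>The squared norm of \<open>cadj T y\<close> is the pairing of
  \<open>T (cadj T y)\<close> with \<open>y\<close>; Cauchy-Schwarz then allows one factor to be
  cancelled.\<close>

lemma norm_cadj_apply_le:
  assumes T: "T \<in> bounded_ops UNIV" and le: "\<And>x. norm (T x) \<le> norm x"
  shows "norm (cadj T y) \<le> norm y"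
proof (cases "cadj T y = 0")
  case False
  have "of_real ((norm (cadj T y))\<^sup>2) = cinner (T (cadj T y)) y"
    by (simp add: cinner_cadj[OF T] cinner_self)
  then have "(norm (cadj T y))\<^sup>2 = cmod (cinner (T (cadj T y)) y)"
    by (metis abs_of_nonneg norm_of_real zero_le_power2)
  also have "\<dots> \<le> norm (T (cadj T y)) * norm y" by (rule cauchy_schwarz_cinner)
  also have "\<dots> \<le> norm (cadj T y) * norm y" by (intro mult_right_mono le) simp
  finally show ?thesis using False by (simp add: power2_eq_square)
qed simp

text \<open>The orthogonal sum makes the graph of a relation between two Hilbert spaces a subspace
  of one Hilbert space.\<close>

instantiation prod :: (complex_hilbert, complex_hilbert) complex_hilbert
begin
definition scaleC_prod_def: "a *\<^sub>C (x :: 'a \<times> 'b) = (a *\<^sub>C fst x, a *\<^sub>C snd x)"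
definition cinner_prod_def: "cinner (x :: 'a \<times> 'b) y = cinner (fst x) (fst y) + cinner (snd x) (snd y)"
instance
proof
  fix x y w :: "'a \<times> 'b" and a b :: complex and r :: real
  show "cinner x y = cnj (cinner y x)"
    unfolding cinner_prod_def complex_cnj_add by (metis cinner_commute)
qed (simp_all add: scaleC_prod_def cinner_prod_def prod_eq_iff scaleC_add_right scaleC_add_left
      scaleC_scaleC scaleR_scaleC cinner_add_left cinner_scaleC_left inner_prod_def
      inner_eq_Re_cinner algebra_simps)
end


section \<open>Projections and extension of contractive relations\<close>

text \<open>A minimizing sequence for the distance to \<open>x\<close> is Cauchy by the
  parallelogram law. As \<open>X\<close> may fail to be closed, the limit lies only in its
  closure.\<close>

lemma subspace_projection:
  fixes X :: "'a::{real_inner,complete_space} set"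
  assumes X: "subspace X"
  obtains p where "p \<in> closure X" "\<And>u. u \<in> X \<Longrightarrow> inner (x - p) u = 0"
proof -
  define g where "g u = (norm (x - u))\<^sup>2" for u
  define I where "I = Inf (g ` X)"
  have bdd: "bdd_below (g ` X)" by (rule bdd_belowI2[of _ 0]) (simp add: g_def)
  have ne: "X \<noteq> {}" using subspace_0[OF X] by auto
  have Ile: "I \<le> g u" if "u \<in> X" for u
    unfolding I_def using that by (intro cInf_lower bdd) simp
  have "\<exists>u\<in>X. g u < I + 1 / Suc n" for n
    using cInf_lessD[of "g ` X" "I + 1 / Suc n"] ne by (auto simp: I_def)
  then obtain p where pX: "\<And>n. p n \<in> X" and p: "\<And>n. g (p n) < I + 1 / Suc n" by metis
  have para: "(norm (u - v))\<^sup>2 = 2 * g u + 2 * g v - 4 * g ((1/2) *\<^sub>R (u + v))" for u v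
    by (simp add: g_def power2_norm_eq_inner algebra_simps inner_commute
        power_divide power_mult_distrib)
  have "Cauchy p"
  proof (rule metric_CauchyI)
    fix e :: real assume e: "e > 0"
    obtain N where N: "4 / e\<^sup>2 < real N" using reals_Archimedean2 by blast
    have "dist (p m) (p n) < e" if "m \<ge> N" "n \<ge> N" for m n
    proof -
      have Npos: "0 < real N" using N e by (smt (verit) zero_less_divide_iff zero_less_power)
      have "1 / real (Suc m) \<le> 1 / real N" "1 / real (Suc n) \<le> 1 / real N"
        using that Npos by (auto intro!: divide_left_mono)
      moreover have "I \<le> g ((1/2) *\<^sub>R (p m + p n))"
        by (intro Ile subspace_scale subspace_add X pX)
      ultimately have "(norm (p m - p n))\<^sup>2 < 4 / real N"
        unfolding para using p[of m] p[of n] by linarith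
      also have "\<dots> < e\<^sup>2" using N Npos e by (simp add: field_simps)
      finally show ?thesis
        using e by (simp add: dist_norm power2_less_imp_less)
    qed
    then show "\<exists>M. \<forall>m\<ge>M. \<forall>n\<ge>M. dist (p m) (p n) < e" by blast
  qed
  then obtain l where l: "p \<longlonglongrightarrow> l"
    using Cauchy_convergent convergent_def by blast
  have gI: "(\<lambda>n. I + 1 / Suc n) \<longlonglongrightarrow> I + 0"
    by (intro tendsto_intros LIMSEQ_inverse_real_of_nat[unfolded inverse_eq_divide])
  have "inner (x - l) u = 0" if u: "u \<in> X" for u
  proof -
    define d where "d = inner (x - l) u"
    \<comment> \<open>Adding 1 keeps \<open>s\<close> positive even for \<open>u = 0\<close>, so
      that \<open>t = d / s\<close> is an admissible test value below.\<close>
    define s where "s = (norm u)\<^sup>2 + 1"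
    have spos: "s > 0" by (simp add: s_def add_nonneg_pos)
    \<comment> \<open>The limit \<open>l\<close> need not lie in \<open>X\<close>, so minimality is
      taken from \<open>p n\<close>, with error \<open>1 / Suc n\<close>, and passed to the
      limit.\<close>
    have *: "g l \<le> g (l + t *\<^sub>R u)" for t
    proof (rule LIMSEQ_le)
      show "(\<lambda>n. g (p n)) \<longlonglongrightarrow> g l"
        unfolding g_def by (intro tendsto_intros l)
      show "(\<lambda>n. g (p n + t *\<^sub>R u) + 1 / Suc n) \<longlonglongrightarrow> g (l + t *\<^sub>R u)"
        unfolding g_def
        by (rule tendsto_eq_intros l LIMSEQ_inverse_real_of_nat[unfolded inverse_eq_divide] refl | simp)+
      have "g (p n) \<le> g (p n + t *\<^sub>R u) + 1 / Suc n" for n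
        using p[of n] Ile[of "p n + t *\<^sub>R u"] by (simp add: subspace_scale subspace_add X pX u)
      then show "\<exists>N. \<forall>n\<ge>N. g (p n) \<le> g (p n + t *\<^sub>R u) + 1 / Suc n" by blast
    qed
    have "2 * t * d \<le> t\<^sup>2 * (norm u)\<^sup>2" for t
      using *[of t] unfolding g_def d_def power2_norm_eq_inner
      by (simp add: algebra_simps inner_commute power2_eq_square)
    from this[of "d / s"] have "2 * (d / s) * d \<le> (d / s)\<^sup>2 * (norm u)\<^sup>2" .
    also have "\<dots> \<le> (d / s)\<^sup>2 * s" by (intro mult_left_mono) (simp_all add: s_def)
    finally have "d * d \<le> 0"
      using spos by (simp add: power2_eq_square field_simps)
    then show ?thesis by (auto simp: d_def[symmetric] mult_le_0_iff)
  qed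
  moreover have "l \<in> closure X" using pX l by (auto simp: closure_sequential)
  ultimately show ?thesis by (rule that[rotated])
qed

text \<open>Closedness is left out on purpose: the relations extended below are images of linear
  maps and are closed only afterwards.\<close>

definition csubspace :: "'a::complex_hilbert set \<Rightarrow> bool" where
  "csubspace X \<longleftrightarrow> 0 \<in> X \<and> (\<forall>x\<in>X. \<forall>y\<in>X. x + y \<in> X) \<and> (\<forall>c. \<forall>x\<in>X. c *\<^sub>C x \<in> X)"

lemma csubspaceD:
  assumes "csubspace X"
  shows "0 \<in> X" "x \<in> X \<Longrightarrow> y \<in> X \<Longrightarrow> x + y \<in> X" "x \<in> X \<Longrightarrow> c *\<^sub>C x \<in> X"
  using assms by (auto simp: csubspace_def)

lemma csubspace_diff: "csubspace X \<Longrightarrow> x \<in> X \<Longrightarrow> y \<in> X \<Longrightarrow> x - y \<in> X"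
  using csubspaceD(2)[of X x "(- 1) *\<^sub>C y"] csubspaceD(3)[of X y "- 1"] by (simp add: scaleC_minus1)

lemma csubspace_imp_subspace: "csubspace X \<Longrightarrow> subspace X"
  by (auto simp: csubspace_def subspace_def scaleR_scaleC)

lemma csubspace_closure:
  assumes "csubspace X"
  shows "csubspace (closure X)"
  unfolding csubspace_def
proof (intro conjI allI ballI)
  show "0 \<in> closure X" using csubspaceD(1)[OF assms] closure_subset by blast
  fix x assume x: "x \<in> closure X"
  then obtain p where p: "\<And>n. p n \<in> X" "p \<longlonglongrightarrow> x" by (auto simp: closure_sequential)
  show "c *\<^sub>C x \<in> closure X" for c
    unfolding closure_sequential
    by (intro exI[of _ "\<lambda>n. c *\<^sub>C p n"] conjI allI csubspaceD(3)[OF assms] p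
        bounded_linear.tendsto[OF bounded_linear_scaleC])
  fix y assume "y \<in> closure X"
  then obtain q where q: "\<And>n. q n \<in> X" "q \<longlonglongrightarrow> y" by (auto simp: closure_sequential)
  show "x + y \<in> closure X"
    unfolding closure_sequential
    by (intro exI[of _ "\<lambda>n. p n + q n"] conjI allI csubspaceD(2)[OF assms] p q tendsto_add)
qed

text \<open>The norm inequality passes to the closure of \<open>G\<close> and makes it the graph of
  a contraction. Projecting onto the closure of the domain first extends it by 0 on the orthogonal
  complement.\<close>

lemma contraction_extension:
  fixes G :: "('a::complex_hilbert \<times> 'b::complex_hilbert) set"
  assumes G: "csubspace G" and le: "\<And>x y. (x, y) \<in> G \<Longrightarrow> norm y \<le> norm x"
  obtains \<omega> :: "'a \<Rightarrow>\<^sub>L 'b" where "\<omega> \<in> bounded_ops UNIV" "\<And>x. norm (\<omega> x) \<le> norm x"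
    "\<And>x y. (x, y) \<in> G \<Longrightarrow> \<omega> x = y" "\<And>x. \<omega> x \<in> closure (snd ` G)"
    "\<And>x. \<forall>(u, y)\<in>G. cinner x u = 0 \<Longrightarrow> \<omega> x = 0"
proof -
  note G' = csubspace_closure[OF G]
  have le': "norm y \<le> norm x" if "(x, y) \<in> closure G" for x y
  proof -
    have "closed {xy :: 'a \<times> 'b. norm (snd xy) \<le> norm (fst xy)}"
      by (intro closed_Collect_le continuous_intros)
    then have "closure G \<subseteq> {xy. norm (snd xy) \<le> norm (fst xy)}"
      by (intro closure_minimal) (auto intro: le)
    then show ?thesis using that by auto
  qed
  have sub: "subspace (fst ` G)"
    by (intro linear_subspace_image csubspace_imp_subspace G bounded_linear.linear
        bounded_linear_fst)
  \<comment> \<open>\<open>p\<close> is the projection of \<open>x\<close> onto the closed domain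
    and \<open>y\<close> is the image of \<open>p\<close>.\<close>
  define P where "P x p y \<longleftrightarrow> (p, y) \<in> closure G \<and> (\<forall>(u, w) \<in> G. cinner (x - p) u = 0)" for x p y
  have ex: "\<exists>p y. P x p y" for x
  proof -
    obtain p where p: "p \<in> closure (fst ` G)" "\<And>u. u \<in> fst ` G \<Longrightarrow> inner (x - p) u = 0"
      using subspace_projection[OF sub] by blast
    obtain xs where xs: "\<And>n. xs n \<in> fst ` G" "xs \<longlonglongrightarrow> p"
      using p(1) by (auto simp: closure_sequential)
    then have "\<forall>n. \<exists>y. (xs n, y) \<in> G" by force
    then obtain ys where ys: "\<And>n. (xs n, ys n) \<in> G" by metis
    have "Cauchy ys"
    proof (rule metric_CauchyI)
      fix e :: real assume "e > 0"
      then obtain N where N: "\<And>m n. m \<ge> N \<Longrightarrow> n \<ge> N \<Longrightarrow> dist (xs m) (xs n) < e"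
        using LIMSEQ_imp_Cauchy[OF xs(2)] unfolding Cauchy_def by blast
      have "norm (ys m - ys n) \<le> norm (xs m - xs n)" for m n
        using csubspace_diff[OF G ys[of m] ys[of n]] by (intro le) simp
      then show "\<exists>M. \<forall>m\<ge>M. \<forall>n\<ge>M. dist (ys m) (ys n) < e"
        using N unfolding dist_norm by (meson le_less_trans)
    qed
    then obtain y where y: "ys \<longlonglongrightarrow> y" using Cauchy_convergent convergent_def by blast
    have "(p, y) \<in> closure G"
      unfolding closure_sequential using ys tendsto_Pair[OF xs(2) y]
      by (intro exI[of _ "\<lambda>n. (xs n, ys n)"]) simp
    moreover have "cinner (x - p) u = 0" if "(u, w) \<in> G" for u w
    proof -
      \<comment> \<open>The projection is orthogonal for the real inner product only; testing with
        \<open>\<i> *\<^sub>C u\<close> as well gives complex orthogonality.\<close>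
      have "(\<i> *\<^sub>C u, \<i> *\<^sub>C w) \<in> G"
        using csubspaceD(3)[OF G that, of \<i>] by (simp add: scaleC_prod_def)
      then have "inner (x - p) u = 0" "inner (x - p) (\<i> *\<^sub>C u) = 0"
        using that by (force intro: p(2))+
      then show ?thesis by (simp add: cinner_eq_inner complex_eq_iff)
    qed
    ultimately show ?thesis unfolding P_def by blast
  qed
  have orth: "cinner d u = 0" if uw: "(u, w) \<in> closure G" and d: "\<forall>(u, w) \<in> G. cinner d u = 0" for d u w
  proof -
    obtain s where s: "\<And>n. s n \<in> G" "s \<longlonglongrightarrow> (u, w)"
      using uw unfolding closure_sequential by blast
    have "(\<lambda>n. cinner d (fst (s n))) \<longlonglongrightarrow> cinner d u"
      using bounded_linear.tendsto[OF bounded_linear_cinner_right tendsto_fst[OF s(2)]] by simp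
    moreover have "cinner d (fst (s n)) = 0" for n
      using d s(1)[of n] by (auto simp: case_prod_beta)
    ultimately show ?thesis by (simp add: LIMSEQ_const_iff)
  qed
  have norm_le: "norm y \<le> norm x" if "P x p y" for x p y
  proof -
    have "norm y \<le> norm p" using that by (auto simp: P_def intro: le')
    moreover have "cinner (x - p) p = 0" using that unfolding P_def by (intro orth[of p y]) auto
    then have "(norm x)\<^sup>2 = (norm (x - p))\<^sup>2 + (norm p)\<^sup>2" using pythagoras[of "x - p" p] by simp
    then have "norm p \<le> norm x"
      by (smt (verit) norm_ge_zero power2_le_imp_le zero_le_power2)
    ultimately show ?thesis by simp
  qed
  have P_add: "P (x + x') (p + p') (y + y')" if "P x p y" "P x' p' y'" for x x' p p' y y'
    unfolding P_def
  proof (intro conjI ballI)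
    show "(p + p', y + y') \<in> closure G"
      using that csubspaceD(2)[OF G', of "(p, y)" "(p', y')"] by (simp add: P_def)
    show "case uw of (u, w) \<Rightarrow> cinner (x + x' - (p + p')) u = 0" if "uw \<in> G" for uw
      using \<open>P x p y\<close> \<open>P x' p' y'\<close> that unfolding P_def
      by (simp add: cinner_add_left cinner_diff_left case_prod_beta)
  qed
  have P_scale: "P (c *\<^sub>C x) (c *\<^sub>C p) (c *\<^sub>C y)" if "P x p y" for x p y c
    unfolding P_def
  proof (intro conjI ballI)
    show "(c *\<^sub>C p, c *\<^sub>C y) \<in> closure G"
      using that csubspaceD(3)[OF G', of "(p, y)" c] by (simp add: P_def scaleC_prod_def)
    show "case uw of (u, w) \<Rightarrow> cinner (c *\<^sub>C x - c *\<^sub>C p) u = 0" if "uw \<in> G" for uw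
      using \<open>P x p y\<close> that unfolding P_def
      by (auto simp: cinner_scaleC_left simp flip: scaleC_diff_right)
  qed
  \<comment> \<open>The difference of the two triples satisfies \<open>P\<close> at 0, and there
    \<open>norm_le\<close> forces the value 0.\<close>
  have unique: "y = y'" if "P x p y" "P x p' y'" for x p y p' y'
    using norm_le[OF P_add[OF that(1) P_scale[OF that(2), of "- 1"]]] by (simp add: scaleC_minus1)
  obtain f where f: "\<And>x. \<exists>p. P x p (f x)" using ex by metis
  have fI: "f x = y" if "P x p y" for x p y
    using f unique that by blast
  have f_add: "f (x + y) = f x + f y" for x y
    using f[of x] f[of y] P_add fI by metis
  have f_scale: "f (c *\<^sub>C x) = c *\<^sub>C f x" for c x
    using f[of x] P_scale fI by metis
  have f_le: "norm (f x) \<le> norm x" for x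
    using f norm_le by blast
  have bl: "bounded_linear f"
    by (rule bounded_linear_intro[where K = 1]) (simp_all add: f_add f_scale f_le scaleR_scaleC)
  note [simp] = bounded_linear_Blinfun_apply[OF bl]
  show thesis
  proof (rule that[of "Blinfun f"])
    show "Blinfun f \<in> bounded_ops UNIV" by (simp add: bounded_ops_def f_scale)
    show "norm (Blinfun f x) \<le> norm x" for x by (simp add: f_le)
    show "Blinfun f x = y" if "(x, y) \<in> G" for x y
      using that closure_subset[of G] by (auto simp: P_def intro!: fI[of x x])
    show "Blinfun f x \<in> closure (snd ` G)" for x
    proof -
      obtain p where "(p, f x) \<in> closure G" using f[of x] unfolding P_def by blast
      then have "f x \<in> snd ` closure G" by force
      also have "\<dots> \<subseteq> closure (snd ` G)"
        by (intro closure_bounded_linear_image_subset bounded_linear_snd)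
      finally show ?thesis by simp
    qed
    show "Blinfun f x = 0" if "\<forall>(u, y)\<in>G. cinner x u = 0" for x
      using that csubspaceD(1)[OF G'] by (auto simp: P_def zero_prod_def intro!: fI[of x 0])
  qed
qed


section \<open>Defect operators\<close>

text \<open>Assembles component maps into one contraction; bounding finite partial sums gives both
  square summability and the norm estimate.\<close>

lemma ell2_operator:
  fixes F :: "'i \<Rightarrow> 'a::complex_hilbert \<Rightarrow> 'b::complex_hilbert"
  assumes add: "\<And>i x y. F i (x + y) = F i x + F i y"
    and scale: "\<And>i c x. F i (c *\<^sub>C x) = c *\<^sub>C F i x"
    and bound: "\<And>I x. finite I \<Longrightarrow> (\<Sum>i\<in>I. (norm (F i x))\<^sup>2) \<le> (norm x)\<^sup>2"
  obtains D :: "'a \<Rightarrow>\<^sub>L ('i, 'b) ell2" where "D \<in> bounded_ops UNIV"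
    "\<And>x i. coord (D x) i = F i x" "\<And>x. norm (D x) \<le> norm x"
proof -
  have summable: "(\<lambda>i. (norm (F i x))\<^sup>2) summable_on UNIV" for x
    by (rule nonneg_bdd_above_summable_on) (auto intro!: bdd_aboveI2 bound)
  define f where "f x = Abs_ell2 (\<lambda>i. F i x)" for x
  have coord: "coord (f x) i = F i x" for x i
    by (simp add: f_def Abs_ell2_inverse summable)
  have f_add: "f (x + y) = f x + f y" for x y
    by (rule ell2_eqI) (simp add: coord coord_add add)
  have f_scale: "f (c *\<^sub>C x) = c *\<^sub>C f x" for c x
    by (rule ell2_eqI) (simp add: coord coord_scaleC scale)
  have f_le: "norm (f x) \<le> norm x" for x
  proof (rule power2_le_imp_le)
    show "(norm (f x))\<^sup>2 \<le> (norm x)\<^sup>2"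
      unfolding norm_ell2_power2 coord by (intro infsum_le_finite_sums summable bound)
  qed simp
  have bl: "bounded_linear f"
    by (rule bounded_linear_intro[where K = 1]) (simp_all add: f_add f_scale f_le scaleR_scaleC)
  show thesis
    by (rule that[of "Blinfun f"])
      (simp_all add: bounded_linear_Blinfun_apply[OF bl] bounded_ops_def f_scale coord f_le)
qed

text \<open>
  Square roots are avoided: with \<open>A = T* T\<close>, the operator \<open>1 - A\<close> is the telescoping sum of
  \<open>A^j (1 - A)^2\<close>, and the even and odd terms are \<open>(A^i (1 - A))* (A^i (1 - A))\<close> and
  \<open>(T A^i (1 - A))* (T A^i (1 - A))\<close>.
\<close>

lemma defect_operator:
  fixes T :: "'a::complex_hilbert \<Rightarrow>\<^sub>L 'b::complex_hilbert"
  assumes T: "T \<in> bounded_ops UNIV" and le: "\<And>x. norm (T x) \<le> norm x"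
  obtains D :: "'a \<Rightarrow>\<^sub>L (nat, 'a \<times> 'b) ell2" where "D \<in> bounded_ops UNIV"
    "\<And>x. (norm (D x))\<^sup>2 = (norm x)\<^sup>2 - (norm (T x))\<^sup>2"
proof -
  define A where "A x = cadj T (T x)" for x
  have inner_A: "inner (A u) v = inner (T u) (T v)" "inner v (A u) = inner (T v) (T u)" for u v
  proof -
    show "inner v (A u) = inner (T v) (T u)" for u v
      by (simp add: A_def inner_eq_Re_cinner cinner_cadj[OF T])
    then show "inner (A u) v = inner (T u) (T v)" by (metis inner_commute)
  qed
  have A_add: "A (x + y) = A x + A y" for x y by (simp add: A_def blinfun.add_right)
  have A_scale: "A (c *\<^sub>C x) = c *\<^sub>C A x" for c x
    by (simp add: A_def bounded_ops_scaleC[OF T] bounded_ops_scaleC[OF cadj_bounded_ops[OF T]])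
  define u where "u j = A ^^ j" for j
  have u_add: "u j (x + y) = u j x + u j y" for j x y
    by (induction j) (simp_all add: u_def A_add)
  have u_scale: "u j (c *\<^sub>C x) = c *\<^sub>C u j x" for j c x
    by (induction j) (simp_all add: u_def A_scale)
  have u_Suc: "u (Suc j) x = A (u j x)" for j x by (simp add: u_def)
  define F where "F j x = (u j x - u (Suc j) x, T (u j x - u (Suc j) x))" for j x
  define b where "b x j = (norm (u j x))\<^sup>2 - (norm (T (u j x)))\<^sup>2" for x j
  \<comment> \<open>One even and one odd term together: (1 - A)^2 (1 + A) = (1 - A) - (1 - A) A^2,
    evaluated at \<open>u j x\<close>, where \<open>b x j\<close> is the quadratic form of 1 -
    A.\<close>
  have norm_F: "(norm (F j x))\<^sup>2 = b x j - b x (Suc j)" for j x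
    unfolding F_def b_def u_Suc norm_prod_def fst_conv snd_conv
      real_sqrt_pow2[OF add_nonneg_nonneg[OF zero_le_power2 zero_le_power2]]
    by (simp add: power2_norm_eq_inner blinfun.diff_right inner_A inner_diff_left inner_diff_right
        inner_commute)
  have b_nonneg: "b x j \<ge> 0" for x j
    using le by (simp add: b_def power_mono)
  have sum_F: "(\<Sum>j<N. (norm (F j x))\<^sup>2) = b x 0 - b x N" for x N
    unfolding norm_F by (rule sum_lessThan_telescope')
  have b0: "b x 0 = (norm x)\<^sup>2 - (norm (T x))\<^sup>2" for x by (simp add: b_def u_def)
  have bound: "(\<Sum>j\<in>I. (norm (F j x))\<^sup>2) \<le> (norm x)\<^sup>2" if I: "finite I" for I x
  proof -
    have "I \<subseteq> {..<Suc (Max I)}" using I by (auto simp: less_Suc_eq_le)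
    then have "(\<Sum>j\<in>I. (norm (F j x))\<^sup>2) \<le> (\<Sum>j<Suc (Max I). (norm (F j x))\<^sup>2)"
      by (intro sum_mono2) auto
    also have "\<dots> \<le> (norm x)\<^sup>2"
      using b_nonneg[of x "Suc (Max I)"] unfolding sum_F b0 by (smt (verit) zero_le_power2)
    finally show ?thesis .
  qed
  have F_add: "F j (x + y) = F j x + F j y" for j x y
    by (simp add: F_def u_add blinfun.add_right blinfun.diff_right algebra_simps)
  have F_scale: "F j (c *\<^sub>C x) = c *\<^sub>C F j x" for j c x
    by (simp add: F_def u_scale scaleC_prod_def bounded_ops_scaleC[OF T] flip: scaleC_diff_right)
  obtain D :: "'a \<Rightarrow>\<^sub>L (nat, 'a \<times> 'b) ell2" where D: "D \<in> bounded_ops UNIV"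
    "\<And>x i. coord (D x) i = F i x"
    by (rule ell2_operator[of F, OF F_add F_scale bound]) (assumption, rule that)
  have "(norm (D x))\<^sup>2 = (norm x)\<^sup>2 - (norm (T x))\<^sup>2" for x
  proof -
    \<comment> \<open>This squeezes \<open>b x j\<close> between 0 and a decrement of the
      decreasing, hence convergent, sequence of squared norms of \<open>u j x\<close>. So the
      telescoping series loses no mass at infinity.\<close>
    have A_le: "norm (A y) \<le> norm (T y)" for y
      unfolding A_def by (intro norm_cadj_apply_le T le)
    have decseq: "decseq (\<lambda>j. (norm (u j x))\<^sup>2)"
      unfolding decseq_Suc_iff u_Suc using A_le le order_trans by (blast intro: power_mono norm_ge_zero)
    obtain L where L: "(\<lambda>j. (norm (u j x))\<^sup>2) \<longlonglongrightarrow> L"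
      using decseq_convergent[OF decseq, of 0] by auto
    have lim0: "(\<lambda>j. (norm (u j x))\<^sup>2 - (norm (u (Suc j) x))\<^sup>2) \<longlonglongrightarrow> L - L"
      by (intro tendsto_diff L LIMSEQ_Suc[OF L])
    have "b x \<longlonglongrightarrow> 0"
    proof (rule tendsto_sandwich[OF _ _ tendsto_const lim0[simplified]])
      show "\<forall>\<^sub>F j in sequentially. b x j \<le> (norm (u j x))\<^sup>2 - (norm (u (Suc j) x))\<^sup>2"
        unfolding b_def u_Suc using A_le by (auto intro!: always_eventually power_mono)
    qed (simp add: b_nonneg)
    then have "(\<lambda>N. b x 0 - b x N) \<longlonglongrightarrow> b x 0 - 0" by (intro tendsto_intros)
    then have "(\<lambda>j. (norm (F j x))\<^sup>2) sums b x 0" unfolding sums_def sum_F by simp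
    then have "((\<lambda>j. (norm (F j x))\<^sup>2) has_sum b x 0) UNIV" by (rule sums_nonneg_imp_has_sum) simp
    then show ?thesis unfolding norm_ell2_power2 D(2) b0 by (rule infsumI)
  qed
  with D(1) show thesis by (rule that)
qed


section \<open>The full Fock space\<close>

text \<open>The adjoint of \<open>creation i\<close>, as \<open>cinner_creation\<close>
  shows.\<close>

lift_definition annihilation :: "'n \<Rightarrow> ('n list, 'a::complex_hilbert) ell2 \<Rightarrow> ('n list, 'a) ell2"
  is "\<lambda>i f \<beta>. f (i # \<beta>)"
proof -
  fix i :: 'n and f :: "'n list \<Rightarrow> 'a"
  assume "(\<lambda>\<alpha>. (norm (f \<alpha>))\<^sup>2) summable_on UNIV"
  then have "(\<lambda>\<alpha>. (norm (f \<alpha>))\<^sup>2) summable_on range (Cons i)"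
    by (rule summable_on_subset_banach) simp
  then show "(\<lambda>\<beta>. (norm (f (i # \<beta>)))\<^sup>2) summable_on UNIV"
    by (subst (asm) summable_on_reindex) (auto simp: o_def)
qed

lemma coord_annihilation: "coord (annihilation i f) \<beta> = coord f (i # \<beta>)"
  by (simp add: annihilation.rep_eq)

lemma creation_add: "creation i (f + g) = creation i f + creation i g"
  by (rule ell2_eqI) (simp add: creation.rep_eq coord_add split: list.split)

lemma creation_scaleC: "creation i (c *\<^sub>C f) = c *\<^sub>C creation i f"
  by (rule ell2_eqI) (simp add: creation.rep_eq coord_scaleC split: list.split)

lemma creation_zero [simp]: "creation i 0 = 0"
  by (rule ell2_eqI) (simp add: creation.rep_eq coord_zero split: list.split)

lemma annihilation_creation: "annihilation i (creation j f) = (if i = j then f else 0)"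
  by (rule ell2_eqI) (simp add: coord_annihilation creation.rep_eq coord_zero)

lemma cinner_creation: "cinner (creation i f) g = cinner f (annihilation i g)"
proof -
  have "cinner (creation i f) g =
      (\<Sum>\<^sub>\<infinity>\<alpha>\<in>range (Cons i). cinner (coord (creation i f) \<alpha>) (coord g \<alpha>))"
    unfolding cinner_ell2_def
  proof (rule infsum_cong_neutral)
    fix \<alpha> assume "\<alpha> \<in> UNIV - range (Cons i)"
    then show "cinner (coord (creation i f) \<alpha>) (coord g \<alpha>) = 0"
      by (cases \<alpha>) (auto simp: creation.rep_eq)
  qed auto
  also have "\<dots> = cinner f (annihilation i g)"
    by (subst infsum_reindex) (simp_all add: o_def cinner_ell2_def creation.rep_eq coord_annihilation)
  finally show ?thesis .
qed

text \<open>The creation operators are isometries with pairwise orthogonal ranges, so they form a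
  row isometry.\<close>

lemma cinner_creation_sum:
  fixes f g :: "'n::finite \<Rightarrow> ('n list, 'a::complex_hilbert) ell2"
  shows "cinner (\<Sum>i\<in>UNIV. creation i (f i)) (\<Sum>i\<in>UNIV. creation i (g i)) = (\<Sum>i\<in>UNIV. cinner (f i) (g i))"
proof -
  have "cinner (creation i a) (creation j b) = (if j = i then cinner a b else 0)"
    for i j and a b :: "('n list, 'a) ell2"
    by (simp add: cinner_creation annihilation_creation)
  then show ?thesis by (simp add: cinner_sum_left cinner_sum_right)
qed

lemma norm_creation_sum:
  fixes f :: "'n::finite \<Rightarrow> ('n list, 'a::complex_hilbert) ell2"
  shows "(norm (\<Sum>i\<in>UNIV. creation i (f i)))\<^sup>2 = (\<Sum>i\<in>UNIV. (norm (f i))\<^sup>2)"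
proof -
  have "complex_of_real ((norm (\<Sum>i\<in>UNIV. creation i (f i)))\<^sup>2) = of_real (\<Sum>i\<in>UNIV. (norm (f i))\<^sup>2)"
    unfolding cinner_self[symmetric] cinner_creation_sum of_real_sum ..
  then show ?thesis by (simp only: of_real_eq_iff)
qed

lemma creation_word_Cons: "creation_word (i # \<alpha>) f = creation i (creation_word \<alpha> f)"
  by (simp add: creation_word_def)

lemma cinner_single: "cinner (single \<gamma> a) g = cinner a (coord g \<gamma>)"
proof -
  have "cinner (single \<gamma> a) g = (\<Sum>\<^sub>\<infinity>i\<in>{\<gamma>}. cinner (coord (single \<gamma> a) i) (coord g i))"
    unfolding cinner_ell2_def by (rule infsum_cong_neutral) (auto simp: single.rep_eq)
  then show ?thesis by (simp add: single.rep_eq)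
qed

lemma single_Cons: "single (i # \<beta>) a = creation i (single \<beta> a)"
  by (rule ell2_eqI) (auto simp: single.rep_eq creation.rep_eq split: list.split)

section \<open>Sums over words by length, and truncation to polynomials\<close>

lemma finite_words_less: "finite {\<alpha> :: 'n::finite list. length \<alpha> < N}"
  by (rule finite_subset[OF _ finite_words[of N]]) auto

lemma sum_words_length_Suc:
  "(\<Sum>\<alpha> :: 'n::finite list | length \<alpha> = Suc p. f \<alpha>) = (\<Sum>i\<in>UNIV. \<Sum>\<beta> | length \<beta> = p. f (i # \<beta>))"
proof -
  have "{\<alpha> :: 'n list. length \<alpha> = Suc p} = (\<lambda>(i, \<beta>). i # \<beta>) ` (UNIV \<times> {\<beta>. length \<beta> = p})"
    by (force simp: length_Suc_conv)
  then show ?thesis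
    by (simp add: sum.reindex inj_on_def sum.cartesian_product case_prod_beta)
qed

lemma sum_words_less:
  "(\<Sum>\<alpha> :: 'n::finite list | length \<alpha> < N. f \<alpha>) = (\<Sum>p<N. \<Sum>\<alpha> | length \<alpha> = p. f \<alpha>)"
proof -
  have "{\<alpha> :: 'n list. length \<alpha> < N} = (\<Union>p<N. {\<alpha>. length \<alpha> = p})" by auto
  moreover have "finite {\<alpha> :: 'n list. length \<alpha> = p}" for p
    by (rule finite_subset[OF _ finite_words[of p]]) auto
  ultimately show ?thesis by (simp only:) (subst sum.UNION_disjoint, auto)
qed

text \<open>The bound is strict: \<open>trunc (Suc k)\<close> projects onto
  \<open>fock_poly k\<close>, while \<open>trunc k q = q\<close> says that \<open>q\<close> has
  degree less than \<open>k\<close>, so that \<open>creation i q\<close> has degree at most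
  \<open>k\<close>.\<close>

lift_definition trunc :: "nat \<Rightarrow> ('n list, 'a::complex_hilbert) ell2 \<Rightarrow> ('n list, 'a) ell2"
  is "\<lambda>N f \<alpha>. if length \<alpha> < N then f \<alpha> else 0"
proof -
  fix N and f :: "'n list \<Rightarrow> 'a"
  assume "(\<lambda>\<alpha>. (norm (f \<alpha>))\<^sup>2) summable_on UNIV"
  then show "(\<lambda>\<alpha>. (norm (if length \<alpha> < N then f \<alpha> else 0))\<^sup>2) summable_on UNIV"
    by (rule summable_on_comparison_test) auto
qed

lemma coord_trunc: "coord (trunc N f) \<alpha> = (if length \<alpha> < N then coord f \<alpha> else 0)"
  by (simp add: trunc.rep_eq)

lemma cinner_trunc:
  fixes f g :: "('n::finite list, 'a::complex_hilbert) ell2"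
  shows "cinner f (trunc N g) = (\<Sum>\<alpha> | length \<alpha> < N. cinner (coord f \<alpha>) (coord g \<alpha>))"
proof -
  have "cinner f (trunc N g) =
      (\<Sum>\<^sub>\<infinity>\<alpha>\<in>{\<alpha>. length \<alpha> < N}. cinner (coord f \<alpha>) (coord g \<alpha>))"
    unfolding cinner_ell2_def by (rule infsum_cong_neutral) (auto simp: coord_trunc)
  then show ?thesis by (simp add: finite_words_less)
qed

lemma trunc_tendsto:
  fixes g :: "('n::finite list, 'a::complex_hilbert) ell2"
  shows "(\<lambda>N. trunc N g) \<longlonglongrightarrow> g"
proof -
  have "filterlim (\<lambda>N. {\<alpha> :: 'n list. length \<alpha> < N}) (finite_subsets_at_top UNIV) sequentially"
    unfolding filterlim_finite_subsets_at_top
  proof (intro allI impI)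
    fix X :: "'n list set" assume X: "finite X \<and> X \<subseteq> UNIV"
    show "\<forall>\<^sub>F N in sequentially. finite {\<alpha> :: 'n list. length \<alpha> < N} \<and> X \<subseteq> {\<alpha>. length \<alpha> < N} \<and>
        {\<alpha> :: 'n list. length \<alpha> < N} \<subseteq> UNIV"
      using eventually_gt_at_top[of "Max (length ` X)"]
    proof eventually_elim
      case (elim N)
      then have "length \<alpha> < N" if "\<alpha> \<in> X" for \<alpha>
        using X Max_ge[of "length ` X" "length \<alpha>"] that
        by (metis finite_imageI imageI le_less_trans)
      then show ?case by (auto simp: finite_words_less)
    qed
  qed
  moreover have "((\<lambda>\<alpha>. (norm (coord g \<alpha>))\<^sup>2) has_sum (norm g)\<^sup>2) UNIV"
    unfolding norm_ell2_power2 by (intro has_sum_infsum coord_summable)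
  ultimately have lim: "(\<lambda>N. \<Sum>\<alpha> | length \<alpha> < N. (norm (coord g \<alpha>))\<^sup>2) \<longlonglongrightarrow> (norm g)\<^sup>2"
    unfolding has_sum_def by (rule filterlim_compose[rotated])
  \<comment> \<open>The remainder is orthogonal to the truncation, so its squared norm is the tail
    of a convergent sum.\<close>
  have "(norm (trunc N g - g))\<^sup>2 = (norm g)\<^sup>2 - (\<Sum>\<alpha> | length \<alpha> < N. (norm (coord g \<alpha>))\<^sup>2)" for N
  proof -
    have "complex_of_real ((norm (trunc N g))\<^sup>2) = of_real (\<Sum>\<alpha> | length \<alpha> < N. (norm (coord g \<alpha>))\<^sup>2)"
      unfolding cinner_self[symmetric] cinner_trunc of_real_sum
      by (intro sum.cong) (simp_all add: coord_trunc)
    moreover have "cinner (g - trunc N g) (trunc N g) = 0"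
      unfolding cinner_trunc by (simp add: coord_minus coord_trunc)
    then have "(norm g)\<^sup>2 = (norm (g - trunc N g))\<^sup>2 + (norm (trunc N g))\<^sup>2"
      using pythagoras[of "g - trunc N g" "trunc N g"] by simp
    ultimately show ?thesis by (simp only: of_real_eq_iff norm_minus_commute)
  qed
  then have "(\<lambda>N. (norm (trunc N g - g))\<^sup>2) \<longlonglongrightarrow> (norm g)\<^sup>2 - (norm g)\<^sup>2"
    using tendsto_diff[OF tendsto_const lim] by (simp only:)
  then have "(\<lambda>N. sqrt ((norm (trunc N g - g))\<^sup>2)) \<longlonglongrightarrow> sqrt 0"
    by (intro tendsto_real_sqrt) simp
  then show ?thesis
    by (simp add: tendsto_norm_zero_iff LIM_zero_iff)
qed

lemma cinner_trunc_tendsto: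
  fixes f g :: "('n::finite list, 'a::complex_hilbert) ell2"
  shows "(\<lambda>N. cinner f (trunc N g)) \<longlonglongrightarrow> cinner f g"
  by (intro bounded_linear.tendsto[OF bounded_linear_cinner_right] trunc_tendsto)

text \<open>A bounded sequence that converges coordinatewise converges weakly, so orthogonality to
  \<open>g\<close> survives without norm convergence.\<close>

lemma cinner_eq_0_weak_limit:
  fixes f g :: "('n::finite list, 'a::complex_hilbert) ell2"
  assumes coord: "\<And>N \<alpha>. length \<alpha> < N \<Longrightarrow> coord (F N) \<alpha> = coord f \<alpha>"
    and bound: "\<And>N. norm (F N) \<le> C" and orth: "\<And>N. cinner (F N) g = 0"
  shows "cinner f g = 0"
proof -
  \<comment> \<open>On words shorter than \<open>N\<close> the vectors \<open>f\<close> and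
    \<open>F N\<close> agree, and \<open>g\<close> may be subtracted because \<open>F N\<close> is
    orthogonal to it.\<close>
  have eq: "cinner f (trunc N g) = cinner (F N) (trunc N g - g)" for N
    using orth unfolding cinner_diff_right cinner_trunc by (simp add: coord)
  have "(\<lambda>N. C * norm (trunc N g - g)) \<longlonglongrightarrow> C * norm (g - g)"
    by (intro tendsto_intros trunc_tendsto)
  then have lim: "(\<lambda>N. C * norm (trunc N g - g)) \<longlonglongrightarrow> 0" by simp
  have "norm (cinner f (trunc N g)) \<le> C * norm (trunc N g - g)" for N
    unfolding eq using cauchy_schwarz_cinner bound
    by (rule order_trans[OF _ mult_right_mono]) simp
  then have "(\<lambda>N. cinner f (trunc N g)) \<longlonglongrightarrow> 0"
    by (intro Lim_null_comparison[OF _ lim] always_eventually allI)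
  then show ?thesis by (rule LIMSEQ_unique[OF cinner_trunc_tendsto])
qed

section \<open>Evaluation and the kernel vectors\<close>

lemma monomial_at_simps [simp]:
  "monomial_at z [] = 1" "monomial_at z (i # \<beta>) = z $ i * monomial_at z \<beta>"
  by (simp_all add: monomial_at_def)

text \<open>Expanding the \<open>p\<close>-th power of the inner product without collecting equal
  monomials gives one term per word.\<close>

lemma sum_monomial_length:
  "(\<Sum>\<alpha> | length \<alpha> = p. monomial_at z \<alpha> * cnj (monomial_at w \<alpha>)) = cinner z w ^ p"
proof (induction p)
  case (Suc p)
  have "(\<Sum>\<alpha> | length \<alpha> = Suc p. monomial_at z \<alpha> * cnj (monomial_at w \<alpha>)) =
      (\<Sum>i\<in>UNIV. z $ i * cnj (w $ i) * (\<Sum>\<beta> | length \<beta> = p. monomial_at z \<beta> * cnj (monomial_at w \<beta>)))"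
    unfolding sum_words_length_Suc by (simp add: sum_distrib_left mult_ac)
  then show ?case unfolding Suc.IH by (simp add: cinner_Cn sum_distrib_right)
qed simp

lemma sum_cmod_monomial_length:
  "(\<Sum>\<alpha> | length \<alpha> = p. (cmod (monomial_at z \<alpha>))\<^sup>2) = (norm z ^ p)\<^sup>2"
proof -
  have "complex_of_real (\<Sum>\<alpha> | length \<alpha> = p. (cmod (monomial_at z \<alpha>))\<^sup>2) = of_real ((norm z ^ p)\<^sup>2)"
    using sum_monomial_length[where z = z and w = z and p = p]
    by (simp add: complex_norm_square[symmetric] cinner_self mult.commute flip: power_mult)
  then show ?thesis by (simp only: of_real_eq_iff)
qed

lemma cinner_neq_1:
  assumes "norm z < 1" "norm (w :: 'a::complex_hilbert) < 1"
  shows "cinner z w \<noteq> 1"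
  using cauchy_schwarz_cinner[of z w] mult_strict_mono[OF assms] by auto

lemma sum_monomial_less:
  assumes "norm z < 1" "norm w < 1"
  shows "(\<Sum>\<alpha> | length \<alpha> < N. monomial_at z \<alpha> * cnj (monomial_at w \<alpha>)) =
    (1 - cinner z w ^ N) / (1 - cinner z w)"
  unfolding sum_words_less sum_monomial_length
  using cinner_neq_1[OF assms] by (simp add: sum_gp_strict)

text \<open>For \<open>norm z < 1\<close>; otherwise the family is not square summable.\<close>

definition fock_kernel :: "complex ^ 'n::finite \<Rightarrow> 'n fock" where
  "fock_kernel z = Abs_ell2 (\<lambda>\<alpha>. cnj (monomial_at z \<alpha>))"

text \<open>Square summability comes from a geometric series: the words of length \<open>p\<close>
  contribute the \<open>p\<close>-th power of the squared norm of \<open>z\<close>.\<close>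

lemma coord_fock_kernel:
  assumes z: "norm z < 1"
  shows "coord (fock_kernel z) \<alpha> = cnj (monomial_at z \<alpha>)"
proof -
  have bound: "(\<Sum>\<alpha>\<in>X. (cmod (monomial_at z \<alpha>))\<^sup>2) \<le> 1 / (1 - (norm z)\<^sup>2)" if "finite X" for X
  proof -
    have r: "(norm z)\<^sup>2 < 1" using z by (simp add: power_less_one_iff abs_square_less_1)
    have "X \<subseteq> {\<alpha>. length \<alpha> < Suc (Max (length ` X))}"
      using that by (auto simp: less_Suc_eq_le)
    then have "(\<Sum>\<alpha>\<in>X. (cmod (monomial_at z \<alpha>))\<^sup>2) \<le>
        (\<Sum>\<alpha> | length \<alpha> < Suc (Max (length ` X)). (cmod (monomial_at z \<alpha>))\<^sup>2)"
      by (intro sum_mono2 finite_words_less) auto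
    also have "\<dots> = (\<Sum>p<Suc (Max (length ` X)). ((norm z)\<^sup>2) ^ p)"
      unfolding sum_words_less sum_cmod_monomial_length by (simp only: power_mult[symmetric] mult.commute)
    also have "\<dots> = (1 - ((norm z)\<^sup>2) ^ Suc (Max (length ` X))) / (1 - (norm z)\<^sup>2)"
      using r by (subst sum_gp_strict) auto
    also have "\<dots> \<le> 1 / (1 - (norm z)\<^sup>2)"
      using r by (intro divide_right_mono) auto
    finally show ?thesis .
  qed
  have "(\<lambda>\<alpha>. (norm (cnj (monomial_at z \<alpha>)))\<^sup>2) summable_on UNIV"
    by (rule nonneg_bdd_above_summable_on) (auto intro!: bdd_aboveI2 bound)
  then show ?thesis by (simp add: fock_kernel_def Abs_ell2_inverse)
qed

text \<open>Kernel vectors are joint eigenvectors of the adjoint creation operators; hence their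
  combinations form a space invariant under these adjoints.\<close>

lemma annihilation_kernel:
  assumes "norm z < 1"
  shows "annihilation i (fock_kernel z \<otimes>\<^sub>2 b) = cnj (z $ i) *\<^sub>C (fock_kernel z \<otimes>\<^sub>2 b)"
  by (rule ell2_eqI)
    (simp add: coord_annihilation coord_tensor coord_scaleC coord_fock_kernel assms scaleC_scaleC)

lemma cinner_kernel_trunc:
  assumes "norm z < 1" "norm w < 1"
  shows "cinner (fock_kernel w \<otimes>\<^sub>2 a) (trunc N (fock_kernel z \<otimes>\<^sub>2 b)) =
    (1 - cinner z w ^ N) / (1 - cinner z w) * cinner a b"
proof -
  have "cinner (fock_kernel w \<otimes>\<^sub>2 a) (trunc N (fock_kernel z \<otimes>\<^sub>2 b)) =
      (\<Sum>\<alpha> | length \<alpha> < N. monomial_at z \<alpha> * cnj (monomial_at w \<alpha>)) * cinner a b"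
    unfolding cinner_trunc sum_distrib_right
    by (intro sum.cong) (simp_all add: coord_tensor coord_fock_kernel assms cinner_scaleC_left
        cinner_scaleC_right mult_ac)
  then show ?thesis by (simp only: sum_monomial_less[OF assms])
qed

lemma cinner_kernel:
  assumes "norm z < 1" "norm w < 1"
  shows "cinner (fock_kernel w \<otimes>\<^sub>2 a) (fock_kernel z \<otimes>\<^sub>2 b) = 1 / (1 - cinner z w) * cinner a b"
proof (rule LIMSEQ_unique[OF cinner_trunc_tendsto])
  have "cmod (cinner z w) < 1"
    using cauchy_schwarz_cinner[of z w] mult_strict_mono[OF assms] by auto
  then have "(\<lambda>N. (1 - cinner z w ^ N) / (1 - cinner z w) * cinner a b)
      \<longlonglongrightarrow> (1 - 0) / (1 - cinner z w) * cinner a b"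
    using cinner_neq_1[OF assms] by (intro tendsto_intros LIMSEQ_power_zero) simp_all
  then show "(\<lambda>N. cinner (fock_kernel w \<otimes>\<^sub>2 a) (trunc N (fock_kernel z \<otimes>\<^sub>2 b)))
      \<longlonglongrightarrow> 1 / (1 - cinner z w) * cinner a b"
    unfolding cinner_kernel_trunc[OF assms] by simp
qed

text \<open>The reproducing property: evaluation at \<open>z\<close> is pairing with the kernel
  vector. It replaces the operator series by an inner product in all later arguments.\<close>

lemma cinner_op_eval:
  fixes \<theta> :: "'h::complex_hilbert \<Rightarrow>\<^sub>L ('n::finite list, 'k::complex_hilbert) ell2"
  assumes z: "norm z < 1"
  shows "cinner (op_eval \<theta> z h) b = cinner (\<theta> h) (fock_kernel z \<otimes>\<^sub>2 b)"
proof -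
  define f where "f p = (\<Sum>\<alpha> | length \<alpha> = p. monomial_at z \<alpha> *\<^sub>C op_coeff \<theta> \<alpha>)" for p
  have f_apply: "f p h = (\<Sum>\<alpha> | length \<alpha> = p. monomial_at z \<alpha> *\<^sub>C coord (\<theta> h) \<alpha>)" for p h
    by (simp add: f_def blinfun.sum_left scaleC_blinfun.rep_eq op_coeff.rep_eq)
  \<comment> \<open>Cauchy-Schwarz over words of length \<open>p\<close> gives the factor
    \<open>norm z ^ p\<close> with no count of words, so the series converges in operator norm on
    the whole ball.\<close>
  have f_le: "norm (f p) \<le> norm \<theta> * norm z ^ p" for p
  proof (rule norm_blinfun_bound)
    fix h
    have "norm (f p h) \<le> (\<Sum>\<alpha> | length \<alpha> = p. cmod (monomial_at z \<alpha>) * norm (coord (\<theta> h) \<alpha>))"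
      unfolding f_apply norm_scaleC[symmetric] by (rule norm_sum)
    also have "\<dots> \<le> norm z ^ p * norm (\<theta> h)"
    proof (rule power2_le_imp_le)
      have "finite {\<alpha> :: 'n list. length \<alpha> = p}"
        by (rule finite_subset[OF _ finite_words[of p]]) auto
      then have "(\<Sum>\<alpha> :: 'n list | length \<alpha> = p. (norm (coord (\<theta> h) \<alpha>))\<^sup>2) \<le> (norm (\<theta> h))\<^sup>2"
        by (rule sum_coord_le)
      then show "(\<Sum>\<alpha> | length \<alpha> = p. cmod (monomial_at z \<alpha>) * norm (coord (\<theta> h) \<alpha>))\<^sup>2
          \<le> (norm z ^ p * norm (\<theta> h))\<^sup>2"
        unfolding power_mult_distrib sum_cmod_monomial_length[symmetric]
        by (intro order_trans[OF Cauchy_Schwarz_ineq_sum] mult_left_mono sum_nonneg) simp_all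
    qed simp
    also have "\<dots> \<le> norm z ^ p * (norm \<theta> * norm h)"
      by (intro mult_left_mono norm_blinfun) simp
    finally show "norm (f p h) \<le> norm \<theta> * norm z ^ p * norm h" by (simp add: mult_ac)
  qed simp
  have "summable (\<lambda>p. norm \<theta> * norm z ^ p)"
    using z by (intro summable_mult summable_geometric) simp
  then have "summable f"
    using f_le by (rule summable_comparison_test')
  then have "(\<lambda>N. \<Sum>p<N. f p) \<longlonglongrightarrow> op_eval \<theta> z"
    unfolding op_eval_def f_def[symmetric] by (rule summable_LIMSEQ)
  then have "(\<lambda>N. cinner (blinfun_apply (\<Sum>p<N. f p) h) b) \<longlonglongrightarrow> cinner (op_eval \<theta> z h) b"
    by (intro bounded_linear.tendsto[OF bounded_linear_cinner_left] tendsto_intros)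
  moreover have "cinner (blinfun_apply (\<Sum>p<N. f p) h) b =
      cinner (\<theta> h) (trunc N (fock_kernel z \<otimes>\<^sub>2 b))" for N
    unfolding cinner_trunc sum_words_less
    by (simp add: blinfun.sum_left f_apply cinner_sum_left coord_tensor coord_fock_kernel z
        cinner_scaleC_left cinner_scaleC_right)
  ultimately have "(\<lambda>N. cinner (\<theta> h) (trunc N (fock_kernel z \<otimes>\<^sub>2 b)))
      \<longlonglongrightarrow> cinner (op_eval \<theta> z h) b"
    by simp
  then show ?thesis by (rule LIMSEQ_unique[OF _ cinner_trunc_tendsto])
qed

section \<open>Lifting\<close>

definition row_creation ::
  "('n::finite \<Rightarrow> ('n list, 'a::complex_hilbert) ell2) \<Rightarrow> ('n list, 'a) ell2" where
  "row_creation f = (\<Sum>i\<in>UNIV. creation i (f i))"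

lemma coord_row_creation [simp]:
  "coord (row_creation f) [] = 0" "coord (row_creation f) (i # \<beta>) = coord (f i) \<beta>"
  by (simp_all add: row_creation_def coord_sum creation.rep_eq sum.delta)

lemma row_creation_zero [simp]: "row_creation (\<lambda>i. 0) = 0"
  by (simp add: row_creation_def)

lemma row_creation_add: "row_creation (\<lambda>i. f i + g i) = row_creation f + row_creation g"
  by (simp add: row_creation_def creation_add sum.distrib)

lemma row_creation_scaleC: "row_creation (\<lambda>i. c *\<^sub>C f i) = c *\<^sub>C row_creation f"
  by (simp add: row_creation_def creation_scaleC scaleC_sum_right)

lemma norm_row_creation: "(norm (row_creation f))\<^sup>2 = (\<Sum>i\<in>UNIV. (norm (f i))\<^sup>2)"
  unfolding row_creation_def by (rule norm_creation_sum)

lemma cinner_row_creation_left: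
  "cinner (row_creation f) g = (\<Sum>i\<in>UNIV. cinner (f i) (annihilation i g))"
  by (simp add: row_creation_def cinner_sum_left cinner_creation)

lemma row_creation_delta: "row_creation (\<lambda>j. if j = i then f else 0) = creation i f"
proof -
  have "creation j (if j = i then f else 0) = (if j = i then creation i f else 0)" for j
    by simp
  then show ?thesis by (simp add: row_creation_def)
qed

lemma norm_vec_power2: "(norm x)\<^sup>2 = (\<Sum>i\<in>UNIV. (norm (x $ i))\<^sup>2)"
  by (simp add: norm_vec_def L2_set_def sum_nonneg)

lemma norm_prod_power2: "(norm x)\<^sup>2 = (norm (fst x))\<^sup>2 + (norm (snd x))\<^sup>2"
  by (simp add: norm_prod_def case_prod_beta)

text \<open>Carries orthogonality from the values in a relation to all values of its extension,
  which lie only in the closure.\<close>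

lemma closed_orthogonal_fst:
  "closed {x :: 'a::complex_hilbert \<times> 'b::complex_hilbert. cinner (fst x) g = 0}"
  by (rule closed_Collect_eq[OF linear_continuous_on[OF bounded_linear_compose[OF
      bounded_linear_cinner_left bounded_linear_fst]] continuous_on_const])

text \<open>
  A contraction \<open>\<omega>\<close> on \<open>'e\<close> is the transition operator of a noncommutative system with state
  space \<open>'e\<close>, and \<open>R\<close> below maps an initial state to the family of all outputs.
\<close>

lemma output_operator:
  fixes \<omega> :: "'e::complex_hilbert \<Rightarrow>\<^sub>L (('n::finite list, 'k::complex_hilbert) ell2 \<times> ('e ^ 'n))"
    and W :: "('n list, 'k) ell2 set"
  assumes \<omega>: "\<omega> \<in> bounded_ops UNIV" and \<omega>_le: "\<And>x. norm (\<omega> x) \<le> norm x"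
    and annihilation: "\<And>v i. v \<in> W \<Longrightarrow> annihilation i v \<in> W"
    and orth: "\<And>x v. v \<in> W \<Longrightarrow> cinner (fst (\<omega> x)) v = 0"
    and wandering: "\<And>x i u. (\<And>v. v \<in> W \<Longrightarrow> cinner u v = 0) \<Longrightarrow> cinner (fst (\<omega> x)) (creation i u) = 0"
  obtains R :: "'e \<Rightarrow>\<^sub>L ('n list, 'k) ell2" where "R \<in> bounded_ops UNIV"
    "\<And>x. norm (R x) \<le> norm x" "\<And>x v. v \<in> W \<Longrightarrow> cinner (R x) v = 0"
    "\<And>x. R x = fst (\<omega> x) + row_creation (\<lambda>i. R (snd (\<omega> x) $ i))"
proof -
  \<comment> \<open>\<open>m N\<close> runs the system for \<open>N\<close> steps from output 0: an
    iteration of the fixed point equation for \<open>R\<close>.\<close>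
  define m where "m = rec_nat (\<lambda>x. 0) (\<lambda>N f x. fst (\<omega> x) + row_creation (\<lambda>i. f (snd (\<omega> x) $ i)))"
  have m_0: "m 0 x = 0" for x by (simp add: m_def)
  have m_Suc: "m (Suc N) x = fst (\<omega> x) + row_creation (\<lambda>i. m N (snd (\<omega> x) $ i))" for N x
    by (simp add: m_def)
  have m_add: "m N (x + y) = m N x + m N y" for N x y
    by (induction N arbitrary: x y)
      (simp_all add: m_0 m_Suc blinfun.add_right row_creation_add algebra_simps)
  have m_scale: "m N (c *\<^sub>C x) = c *\<^sub>C m N x" for N c x
    by (induction N arbitrary: x)
      (simp_all add: m_0 m_Suc bounded_ops_scaleC[OF \<omega>] scaleC_prod_def scaleC_vec_def
        row_creation_scaleC scaleC_add_right)
  have m_orth: "cinner (m N x) v = 0" if "v \<in> W" for N x v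
    using that by (induction N arbitrary: x v)
      (simp_all add: m_0 m_Suc cinner_add_left orth cinner_row_creation_left annihilation)
  have m_le: "(norm (m N x))\<^sup>2 \<le> (norm x)\<^sup>2" for N x
  proof (induction N arbitrary: x)
    case (Suc N)
    \<comment> \<open>Earlier outputs are orthogonal to \<open>W\<close>, so
      \<open>wandering\<close> applies and the present output is orthogonal to the shifted later
      ones.\<close>
    have "cinner (fst (\<omega> x)) (row_creation (\<lambda>i. m N (snd (\<omega> x) $ i))) = 0"
      by (simp add: row_creation_def cinner_sum_right wandering m_orth)
    then have "(norm (m (Suc N) x))\<^sup>2 =
        (norm (fst (\<omega> x)))\<^sup>2 + (\<Sum>i\<in>UNIV. (norm (m N (snd (\<omega> x) $ i)))\<^sup>2)"
      unfolding m_Suc by (simp add: pythagoras norm_row_creation)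
    also have "\<dots> \<le> (norm (fst (\<omega> x)))\<^sup>2 + (\<Sum>i\<in>UNIV. (norm (snd (\<omega> x) $ i))\<^sup>2)"
      by (intro add_left_mono sum_mono Suc.IH)
    also have "\<dots> = (norm (\<omega> x))\<^sup>2"
      unfolding norm_prod_power2[of "\<omega> x"] norm_vec_power2 ..
    also have "\<dots> \<le> (norm x)\<^sup>2" by (intro power_mono \<omega>_le) simp
    finally show ?case .
  qed (simp add: m_0)
  have m_stable: "coord (m N x) \<alpha> = coord (m N' x) \<alpha>" if "length \<alpha> < N" "length \<alpha> < N'" for N N' x \<alpha>
    using that
  proof (induction \<alpha> arbitrary: N N' x)
    case Nil
    then show ?case by (cases N; cases N') (simp_all add: m_Suc coord_add)
  next
    case (Cons i \<alpha>)
    from Cons.prems obtain M M' where "N = Suc M" "N' = Suc M'"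
      by (cases N; cases N') auto
    with Cons.prems show ?case
      by (auto simp: m_Suc coord_add intro!: Cons.IH)
  qed
  \<comment> \<open>By \<open>m_stable\<close>, the coefficient at a word is final after one step
    more than its length.\<close>
  define F where "F \<alpha> x = coord (m (Suc (length \<alpha>)) x) \<alpha>" for \<alpha> x
  have F_add: "F \<alpha> (x + y) = F \<alpha> x + F \<alpha> y" for \<alpha> x y by (simp add: F_def m_add coord_add)
  have F_scale: "F \<alpha> (c *\<^sub>C x) = c *\<^sub>C F \<alpha> x" for \<alpha> c x by (simp add: F_def m_scale coord_scaleC)
  have F_bound: "(\<Sum>\<alpha>\<in>I. (norm (F \<alpha> x))\<^sup>2) \<le> (norm x)\<^sup>2" if I: "finite I" for I x
  proof -
    define N where "N = Suc (Max (length ` I))"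
    have "F \<alpha> x = coord (m N x) \<alpha>" if "\<alpha> \<in> I" for \<alpha>
      unfolding F_def N_def using that I by (intro m_stable) (auto simp: less_Suc_eq_le)
    then have "(\<Sum>\<alpha>\<in>I. (norm (F \<alpha> x))\<^sup>2) = (\<Sum>\<alpha>\<in>I. (norm (coord (m N x) \<alpha>))\<^sup>2)" by simp
    also have "\<dots> \<le> (norm (m N x))\<^sup>2" by (rule sum_coord_le[OF I])
    also have "\<dots> \<le> (norm x)\<^sup>2" by (rule m_le)
    finally show ?thesis .
  qed
  obtain R :: "'e \<Rightarrow>\<^sub>L ('n list, 'k) ell2" where R: "R \<in> bounded_ops UNIV"
    and coord_R: "\<And>x \<alpha>. coord (R x) \<alpha> = F \<alpha> x" and R_le: "\<And>x. norm (R x) \<le> norm x"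
    by (rule ell2_operator[of F, OF F_add F_scale F_bound]) (assumption, rule that)
  show thesis
  proof (rule that[OF R R_le])
    show "cinner (R x) v = 0" if "v \<in> W" for x v
    \<comment> \<open>The iterates are known to approach \<open>R x\<close> only coordinatewise with
      bounded norms, so a weak limit is used.\<close>
    proof (rule cinner_eq_0_weak_limit)
      show "coord (m N x) \<alpha> = coord (R x) \<alpha>" if "length \<alpha> < N" for N \<alpha>
        unfolding coord_R F_def using that by (intro m_stable) simp_all
      show "norm (m N x) \<le> norm x" for N by (rule power2_le_imp_le[OF m_le]) simp
      show "cinner (m N x) v = 0" for N using that by (rule m_orth)
    qed
    show "R x = fst (\<omega> x) + row_creation (\<lambda>i. R (snd (\<omega> x) $ i))" for x
    proof (rule ell2_eqI)
      show "coord (R x) \<alpha> = coord (fst (\<omega> x) + row_creation (\<lambda>i. R (snd (\<omega> x) $ i))) \<alpha>" for \<alpha>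
        by (cases \<alpha>) (simp_all add: coord_R F_def coord_add m_Suc)
    qed
  qed
qed

text \<open>\<open>T_range\<close> places the range of \<open>T\<close> in the closed span of
  \<open>W\<close>, and \<open>T_creation\<close> is intertwining seen only through pairings with
  \<open>W\<close>. A correction orthogonal to \<open>W\<close> makes the intertwining exact and
  keeps those pairings, which carry the interpolation data.\<close>

lemma relaxed_lifting:
  fixes T :: "('n::finite list, 'h::complex_hilbert) ell2 \<Rightarrow>\<^sub>L ('n list, 'k::complex_hilbert) ell2"
    and W :: "('n list, 'k) ell2 set"
  assumes T: "T \<in> bounded_ops UNIV" and T_le: "\<And>q. norm (T q) \<le> norm q"
    and annihilation: "\<And>v i. v \<in> W \<Longrightarrow> annihilation i v \<in> W"
    and T_range: "\<And>x q. (\<And>v. v \<in> W \<Longrightarrow> cinner x v = 0) \<Longrightarrow> cinner x (T q) = 0"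
    and T_creation: "\<And>q v i. trunc k q = q \<Longrightarrow> v \<in> W \<Longrightarrow>
      cinner (T (creation i q)) v = cinner (creation i (T q)) v"
  obtains \<theta> :: "'h \<Rightarrow>\<^sub>L ('n list, 'k) ell2" where "\<theta> \<in> bounded_ops UNIV" "mult_op_norm k \<theta> \<le> 1"
    "\<And>h v. v \<in> W \<Longrightarrow> cinner (\<theta> h) v = cinner (T (single [] h)) v"
proof -
  obtain D :: "('n list, 'h) ell2 \<Rightarrow>\<^sub>L (nat, ('n list, 'h) ell2 \<times> ('n list, 'k) ell2) ell2"
    where D: "D \<in> bounded_ops UNIV"
      and norm_D: "\<And>x. (norm (D x))\<^sup>2 = (norm x)\<^sup>2 - (norm (T x))\<^sup>2"
    by (rule defect_operator[OF T T_le]) (rule that)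
  \<comment> \<open>For \<open>q\<close> in \<open>P\<close> this is the component of the first term
    orthogonal to \<open>W\<close>; \<open>d_orth\<close> expresses this without naming a
    projection.\<close>
  define d where "d q = row_creation (\<lambda>i. T (q i)) - T (row_creation q)" for q
  define P where "P = {q :: 'n \<Rightarrow> ('n list, 'h) ell2. \<forall>i. trunc k (q i) = q i}"
  have d_add: "d (\<lambda>i. q i + r i) = d q + d r" for q r
    by (simp add: d_def blinfun.add_right row_creation_add)
  have d_scale: "d (\<lambda>i. c *\<^sub>C q i) = c *\<^sub>C d q" for c q
    by (simp add: d_def row_creation_scaleC bounded_ops_scaleC[OF T] scaleC_diff_right)
  have d_orth: "cinner (d q) v = 0" if "q \<in> P" "v \<in> W" for q v
    using that T_creation
    by (simp add: P_def d_def row_creation_def blinfun.sum_right cinner_diff_left cinner_sum_left)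
  have P_0: "(\<lambda>i. 0) \<in> P"
    by (auto simp: P_def coord_trunc coord_zero intro: ell2_eqI)
  have P_coord: "q \<in> P \<longleftrightarrow> (\<forall>i \<alpha>. length \<alpha> \<ge> k \<longrightarrow> coord (q i) \<alpha> = 0)" for q
  proof -
    have "trunc k f = f \<longleftrightarrow> (\<forall>\<alpha>. length \<alpha> \<ge> k \<longrightarrow> coord f \<alpha> = 0)" for f :: "('n list, 'h) ell2"
      by (metis coord_trunc ell2_eqI not_less)
    then show ?thesis by (simp add: P_def)
  qed
  define G where "G = (\<lambda>q. (D (row_creation q), (d q, \<chi> i. D (q i)))) ` P"
  have "csubspace G"
    unfolding csubspace_def
  proof (intro conjI ballI allI)
    have "d (\<lambda>i. 0) = 0" by (simp add: d_def)
    then show "0 \<in> G"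
      unfolding G_def using P_0
      by (intro image_eqI[of _ _ "\<lambda>i. 0"]) (simp_all add: zero_prod_def vec_eq_iff)
    fix x assume "x \<in> G"
    then obtain q where q: "q \<in> P" "x = (D (row_creation q), (d q, \<chi> i. D (q i)))"
      unfolding G_def by blast
    show "c *\<^sub>C x \<in> G" for c
      unfolding G_def using q
      by (intro image_eqI[of _ _ "\<lambda>i. c *\<^sub>C q i"])
        (simp_all add: P_coord coord_scaleC d_scale row_creation_scaleC bounded_ops_scaleC[OF D]
          scaleC_prod_def vec_eq_iff scaleC_vec_def)
    fix y assume "y \<in> G"
    then obtain r where r: "r \<in> P" "y = (D (row_creation r), (d r, \<chi> i. D (r i)))"
      unfolding G_def by blast
    show "x + y \<in> G"
      unfolding G_def using q r
      by (intro image_eqI[of _ _ "\<lambda>i. q i + r i"])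
        (simp_all add: P_coord coord_add d_add row_creation_add blinfun.add_right vec_eq_iff)
  qed
  moreover have "norm y \<le> norm x" if xy: "(x, y) \<in> G" for x y
  proof -
    obtain q where q: "q \<in> P" and x: "x = D (row_creation q)" and y: "y = (d q, \<chi> i. D (q i))"
      using xy unfolding G_def by blast
    \<comment> \<open>Pythagoras for this orthogonal pair, combined with \<open>norm_D\<close>,
      shows that the relation is isometric.\<close>
    have "cinner (d q) (T (row_creation q)) = 0" by (intro T_range d_orth q)
    then have "(norm (d q + T (row_creation q)))\<^sup>2 = (norm (d q))\<^sup>2 + (norm (T (row_creation q)))\<^sup>2"
      by (rule pythagoras)
    then have "(\<Sum>i\<in>UNIV. (norm (T (q i)))\<^sup>2) = (norm (d q))\<^sup>2 + (norm (T (row_creation q)))\<^sup>2"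
      by (simp add: d_def norm_row_creation)
    then have "(norm y)\<^sup>2 = (norm x)\<^sup>2"
      by (simp add: x y norm_prod_power2[of "(_, _)"] norm_vec_power2 norm_D norm_row_creation sum_subtractf)
    then show ?thesis by (simp add: power2_eq_iff_nonneg)
  qed
  ultimately obtain \<omega> :: "(nat, ('n list, 'h) ell2 \<times> ('n list, 'k) ell2) ell2 \<Rightarrow>\<^sub>L
      (('n list, 'k) ell2 \<times> ((nat, ('n list, 'h) ell2 \<times> ('n list, 'k) ell2) ell2 ^ 'n))"
    where \<omega>: "\<omega> \<in> bounded_ops UNIV" and \<omega>_le: "\<And>x. norm (\<omega> x) \<le> norm x"
      and \<omega>_eq: "\<And>x y. (x, y) \<in> G \<Longrightarrow> \<omega> x = y" and \<omega>_range: "\<And>x. \<omega> x \<in> closure (snd ` G)"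
    by (rule contraction_extension) (assumption, rule that)
  have \<omega>_orth: "cinner (fst (\<omega> x)) g = 0" if g: "\<And>q. q \<in> P \<Longrightarrow> cinner (d q) g = 0" for x g
  proof -
    have "closure (snd ` G) \<subseteq> {x. cinner (fst x) g = 0}"
      by (rule closure_minimal[OF _ closed_orthogonal_fst]) (auto simp: G_def g)
    then show ?thesis using \<omega>_range by blast
  qed
  \<comment> \<open>Invariance of \<open>W\<close> makes \<open>creation i u\<close> orthogonal to
    \<open>W\<close> again, hence to the range of \<open>T\<close>. Its pairing with the row of the
    \<open>T (q i)\<close> reduces to that of \<open>u\<close> with \<open>T (q i)\<close>, also
    0.\<close>
  have wandering: "cinner (d q) (creation i u) = 0"
    if q: "q \<in> P" and u: "\<And>v. v \<in> W \<Longrightarrow> cinner u v = 0" for q i u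
  proof -
    have "cinner (creation i u) v = 0" if "v \<in> W" for v
      using that by (simp add: cinner_creation annihilation u)
    then have "cinner (creation i u) (T (row_creation q)) = 0" by (rule T_range)
    moreover have "cinner u (T (q i)) = 0" using u by (rule T_range)
    moreover have "annihilation i (row_creation (\<lambda>i. T (q i))) = T (q i)"
      by (rule ell2_eqI) (simp add: coord_annihilation)
    ultimately have "cinner (creation i u) (d q) = 0"
      by (simp add: d_def cinner_diff_right cinner_creation)
    then show ?thesis by (rule cinner_zero_commute)
  qed
  obtain R :: "(nat, ('n list, 'h) ell2 \<times> ('n list, 'k) ell2) ell2 \<Rightarrow>\<^sub>L ('n list, 'k) ell2"
    where R: "R \<in> bounded_ops UNIV" and R_le: "\<And>x. norm (R x) \<le> norm x"
      and R_orth: "\<And>x v. v \<in> W \<Longrightarrow> cinner (R x) v = 0"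
      and R_eq: "\<And>x. R x = fst (\<omega> x) + row_creation (\<lambda>i. R (snd (\<omega> x) $ i))"
  proof (rule output_operator[OF \<omega> \<omega>_le annihilation])
    show "cinner (fst (\<omega> x)) v = 0" if "v \<in> W" for x v
      using that by (intro \<omega>_orth d_orth)
    show "cinner (fst (\<omega> x)) (creation i u) = 0" if "\<And>v. v \<in> W \<Longrightarrow> cinner u v = 0" for x i u
      using that by (intro \<omega>_orth wandering)
  qed (assumption, rule that)
  define M where "M = T + (R o\<^sub>L D)"
  have M: "M q = T q + R (D q)" for q by (simp add: M_def blinfun.add_left)
  have M_creation: "M (creation i q) = creation i (M q)" if q: "trunc k q = q" for i q
  proof -
    \<comment> \<open>With this one-entry tuple, \<open>R_eq\<close> reads R D S_i q = S_i T q - T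
      S_i q + S_i R D q; the terms in \<open>T\<close> cancel in \<open>M\<close>.\<close>
    define r where "r j = (if j = i then q else 0)" for j
    have Tr: "T (r j) = (if j = i then T q else 0)" and RDr: "R (D (r j)) = (if j = i then R (D q) else 0)" for j
      by (simp_all add: r_def)
    have r: "row_creation r = creation i q" unfolding r_def by (rule row_creation_delta)
    have "trunc k (r j) = r j" for j
      using q by (simp add: r_def) (auto intro: ell2_eqI simp: coord_trunc coord_zero)
    then have "(D (creation i q), (d r, \<chi> j. D (r j))) \<in> G"
      unfolding G_def P_def by (intro image_eqI[of _ _ r]) (simp_all add: r)
    then have "R (D (creation i q)) = d r + row_creation (\<lambda>j. R (D (r j)))"
      by (subst R_eq) (simp add: \<omega>_eq)
    then show ?thesis
      by (simp add: M d_def r Tr RDr row_creation_delta creation_add)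
  qed
  have norm_single: "norm (single \<alpha> a) = norm a" for \<alpha> :: "'n list" and a :: 'h
  proof -
    have "complex_of_real ((norm (single \<alpha> a))\<^sup>2) = of_real ((norm a)\<^sup>2)"
      unfolding cinner_self[symmetric] cinner_single by (simp add: single.rep_eq)
    then show ?thesis by (simp only: of_real_eq_iff power2_eq_iff_nonneg norm_ge_zero)
  qed
  have single_add: "single \<alpha> (a + b) = single \<alpha> a + single \<alpha> b" for \<alpha> :: "'n list" and a b :: 'h
    by (rule ell2_eqI) (simp add: single.rep_eq coord_add)
  have single_scale: "single \<alpha> (c *\<^sub>C a) = c *\<^sub>C single \<alpha> a" for \<alpha> :: "'n list" and a :: 'h and c
    by (rule ell2_eqI) (simp add: single.rep_eq coord_scaleC)
  have bl: "bounded_linear (single [] :: 'h \<Rightarrow> ('n list, 'h) ell2)"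
    by (rule bounded_linear_intro[where K = 1]) (simp_all add: norm_single single_add single_scale scaleR_scaleC)
  define \<theta> where "\<theta> = M o\<^sub>L Blinfun (single [])"
  have \<theta>: "\<theta> h = M (single [] h)" for h
    by (simp add: \<theta>_def bounded_linear_Blinfun_apply[OF bl])
  \<comment> \<open>Removing the first letter leaves a word of length less than \<open>k\<close>, so
    commutation below degree \<open>k\<close> reaches all words up to length
    \<open>k\<close>.\<close>
  have M_single: "M (single \<alpha> h) = creation_word \<alpha> (\<theta> h)" if "length \<alpha> \<le> k" for \<alpha> h
    using that
  proof (induction \<alpha>)
    case Nil
    then show ?case by (simp add: \<theta> creation_word_def)
  next
    case (Cons i \<alpha>)
    have "trunc k (single \<alpha> h) = single \<alpha> h"
      using Cons.prems by (intro ell2_eqI) (auto simp: coord_trunc single.rep_eq)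
    then show ?case
      using Cons by (simp add: single_Cons creation_word_Cons M_creation)
  qed
  have mult_op: "mult_op \<theta> q = M q" if "q \<in> fock_poly k" for q
  proof -
    have "q = (\<Sum>\<alpha> | length \<alpha> \<le> k. single \<alpha> (coord q \<alpha>))"
    proof (rule ell2_eqI)
      show "coord q \<beta> = coord (\<Sum>\<alpha> | length \<alpha> \<le> k. single \<alpha> (coord q \<alpha>)) \<beta>" for \<beta>
        using that unfolding coord_sum
        by (auto simp: single.rep_eq finite_words fock_poly_def not_le[symmetric])
    qed
    then have "M q = M (\<Sum>\<alpha> | length \<alpha> \<le> k. single \<alpha> (coord q \<alpha>))" by (rule arg_cong)
    also have "\<dots> = (\<Sum>\<alpha> | length \<alpha> \<le> k. M (single \<alpha> (coord q \<alpha>)))"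
      by (rule blinfun.sum_right)
    finally show ?thesis unfolding mult_op_altdef[OF that] by (simp add: M_single)
  qed
  have M_le: "norm (M q) \<le> norm q" for q
  proof (rule power2_le_imp_le)
    \<comment> \<open>The correction is orthogonal to the range of \<open>T\<close>, and its norm is
      at most that of \<open>D q\<close>, exactly the room that \<open>T\<close> leaves.\<close>
    have "cinner (R (D q)) (T q) = 0" by (intro T_range R_orth)
    then have "(norm (M q))\<^sup>2 = (norm (T q))\<^sup>2 + (norm (R (D q)))\<^sup>2"
      unfolding M by (rule pythagoras[OF cinner_zero_commute])
    also have "\<dots> \<le> (norm (T q))\<^sup>2 + (norm (D q))\<^sup>2"
      by (intro add_left_mono power_mono R_le) simp
    also have "\<dots> = (norm q)\<^sup>2" by (simp add: norm_D)
    finally show "(norm (M q))\<^sup>2 \<le> (norm q)\<^sup>2" .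
  qed simp
  show thesis
  proof (rule that[of \<theta>])
    show "\<theta> \<in> bounded_ops UNIV"
      by (simp add: bounded_ops_def \<theta> M single_scale bounded_ops_scaleC[OF T] bounded_ops_scaleC[OF R]
          bounded_ops_scaleC[OF D] scaleC_add_right)
    show "mult_op_norm k \<theta> \<le> 1"
      unfolding mult_op_norm_def
    proof (rule cSUP_least)
      have "(0 :: ('n list, 'h) ell2) \<in> {q \<in> fock_poly k. norm q \<le> 1}"
        by (simp add: fock_poly_def coord_zero)
      then show "{q \<in> fock_poly k :: ('n list, 'h) ell2 set. norm q \<le> 1} \<noteq> {}" by blast
      show "norm (mult_op \<theta> q) \<le> 1" if "q \<in> {q \<in> fock_poly k. norm q \<le> 1}" for q
        using that M_le[of q] by (simp add: mult_op)
    qed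
    show "cinner (\<theta> h) v = cinner (T (single [] h)) v" if "v \<in> W" for h v
      using that by (simp add: \<theta> M cinner_add_left R_orth)
  qed
qed

section \<open>The interpolation problem\<close>

lemma cinner_cadj_left:
  "T \<in> bounded_ops UNIV \<Longrightarrow> cinner (cadj T y) x = cinner y (T x)"
  by (metis cinner_cadj cinner_commute)

lemma trunc_add: "trunc N (f + g) = trunc N f + trunc N g"
  by (rule ell2_eqI) (simp add: coord_trunc coord_add)

lemma trunc_scaleC: "trunc N (c *\<^sub>C f) = c *\<^sub>C trunc N f"
  by (rule ell2_eqI) (simp add: coord_trunc coord_scaleC)

lemma trunc_sum: "trunc N (\<Sum>j\<in>J. f j) = (\<Sum>j\<in>J. trunc N (f j))"
  by (rule ell2_eqI) (simp add: coord_trunc coord_sum)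

lemma cinner_trunc_left: "cinner (trunc N f) g = cinner f (trunc N g)"
  unfolding cinner_ell2_def by (rule infsum_cong) (simp add: coord_trunc)

lemma trunc_trunc: "trunc M (trunc N f) = trunc (min M N) f"
  by (rule ell2_eqI) (simp add: coord_trunc)

lemma annihilation_trunc: "annihilation i (trunc (Suc N) f) = trunc N (annihilation i f)"
  by (rule ell2_eqI) (simp add: coord_trunc coord_annihilation)

lemma annihilation_sum: "annihilation i (\<Sum>j\<in>J. f j) = (\<Sum>j\<in>J. annihilation i (f j))"
  by (rule ell2_eqI) (simp add: coord_annihilation coord_sum)

lemma tensor_add_right: "f \<otimes>\<^sub>2 (a + b) = f \<otimes>\<^sub>2 a + f \<otimes>\<^sub>2 b"
  by (rule ell2_eqI) (simp add: coord_tensor coord_add scaleC_add_right)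

lemma tensor_scaleC_right: "f \<otimes>\<^sub>2 (c *\<^sub>C a) = c *\<^sub>C (f \<otimes>\<^sub>2 a)"
  by (rule ell2_eqI) (simp add: coord_tensor coord_scaleC scaleC_scaleC mult.commute)

lemma tensor_zero_right [simp]: "f \<otimes>\<^sub>2 0 = 0"
  by (rule ell2_eqI) (simp add: coord_tensor coord_zero)

text \<open>With \<open>B\<close> this is the vector v of the overview; with \<open>C\<close> it is
  w before truncation.\<close>

definition kernel_comb ::
  "nat set \<Rightarrow> (nat \<Rightarrow> complex ^ 'n::finite) \<Rightarrow> (nat \<Rightarrow> 'a::complex_hilbert \<Rightarrow>\<^sub>L 'y::complex_hilbert) \<Rightarrow>
     (nat \<Rightarrow> 'y) \<Rightarrow> ('n list, 'a) ell2" where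
  "kernel_comb J z B y = (\<Sum>j\<in>J. fock_kernel (z j) \<otimes>\<^sub>2 cadj (B j) (y j))"

lemma kernel_comb_add:
  "kernel_comb J z B (\<lambda>j. x j + y j) = kernel_comb J z B x + kernel_comb J z B y"
  by (simp add: kernel_comb_def blinfun.add_right tensor_add_right sum.distrib)

lemma kernel_comb_scaleC:
  assumes "\<And>j. j \<in> J \<Longrightarrow> B j \<in> bounded_ops UNIV"
  shows "kernel_comb J z B (\<lambda>j. c *\<^sub>C y j) = c *\<^sub>C kernel_comb J z B y"
  by (simp add: kernel_comb_def bounded_ops_scaleC[OF cadj_bounded_ops[OF assms]]
      tensor_scaleC_right scaleC_sum_right)

lemma kernel_comb_delta:
  assumes "finite J" "j \<in> J"
  shows "kernel_comb J z B (\<lambda>i. if i = j then y else 0) = fock_kernel (z j) \<otimes>\<^sub>2 cadj (B j) y"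
proof -
  have "kernel_comb J z B (\<lambda>i. if i = j then y else 0) =
      (\<Sum>i\<in>J. if i = j then fock_kernel (z j) \<otimes>\<^sub>2 cadj (B j) y else 0)"
    unfolding kernel_comb_def by (rule sum.cong) (auto simp: blinfun.zero_right)
  then show ?thesis using assms by simp
qed

lemma annihilation_kernel_comb:
  assumes "\<And>j. j \<in> J \<Longrightarrow> B j \<in> bounded_ops UNIV" "\<And>j. j \<in> J \<Longrightarrow> norm (z j) < 1"
  shows "annihilation i (kernel_comb J z B y) = kernel_comb J z B (\<lambda>j. cnj (z j $ i) *\<^sub>C y j)"
  unfolding kernel_comb_def annihilation_sum
  by (rule sum.cong) (simp_all add: annihilation_kernel assms tensor_scaleC_right
      bounded_ops_scaleC[OF cadj_bounded_ops[OF assms(1)]])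

lemma cinner_creation_word_kernel:
  assumes "norm z < 1"
  shows "cinner (creation_word \<alpha> f) (fock_kernel z \<otimes>\<^sub>2 b) = monomial_at z \<alpha> * cinner f (fock_kernel z \<otimes>\<^sub>2 b)"
  by (induction \<alpha>)
    (simp_all add: creation_word_Cons cinner_creation annihilation_kernel[OF assms] cinner_scaleC_right,
      simp add: creation_word_def)

section \<open>Gram matrices and the operator order\<close>

text \<open>The map \<open>P\<close> is the identity or a truncation.\<close>

lemma dsum_inner_gram:
  fixes B :: "nat \<Rightarrow> 'a::complex_hilbert \<Rightarrow>\<^sub>L 'y::complex_hilbert"
  assumes B: "\<And>j. j \<in> J \<Longrightarrow> B j \<in> bounded_ops UNIV"
    and P_sum: "\<And>f. P (\<Sum>j\<in>J. f j) = (\<Sum>j\<in>J. P (f j))"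
    and P: "\<And>j q a b. j \<in> J \<Longrightarrow> q \<in> J \<Longrightarrow>
      cinner (fock_kernel (z q) \<otimes>\<^sub>2 a) (P (fock_kernel (z j) \<otimes>\<^sub>2 b)) = c j q * cinner a b"
  shows "dsum_inner J (opmat_apply J (\<lambda>j q. c j q *\<^sub>C (B j o\<^sub>L cadj (B q))) x) y =
    cinner (kernel_comb J z B x) (P (kernel_comb J z B y))"
proof -
  have "dsum_inner J (opmat_apply J (\<lambda>j q. c j q *\<^sub>C (B j o\<^sub>L cadj (B q))) x) y =
      (\<Sum>j\<in>J. \<Sum>q\<in>J. c j q * cinner (cadj (B q) (x q)) (cadj (B j) (y j)))"
    unfolding dsum_inner_def opmat_apply_def
    by (intro sum.cong) (simp_all add: cinner_sum_left scaleC_blinfun.rep_eq cinner_scaleC_left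
        cinner_cadj[OF B])
  also have "\<dots> = (\<Sum>q\<in>J. \<Sum>j\<in>J. cinner (fock_kernel (z q) \<otimes>\<^sub>2 cadj (B q) (x q))
      (P (fock_kernel (z j) \<otimes>\<^sub>2 cadj (B j) (y j))))"
    by (subst sum.swap) (simp add: P)
  also have "\<dots> = cinner (kernel_comb J z B x) (P (kernel_comb J z B y))"
    by (simp add: kernel_comb_def P_sum cinner_sum_left cinner_sum_right, rule sum.swap)
  finally show ?thesis .
qed

text \<open>Self-adjointness on the sum of the \<open>Y j\<close> includes mapping it into itself;
  the outer factor \<open>B j\<close> ensures this.\<close>

lemma opmat_apply_dsum:
  assumes B: "\<And>j. j \<in> J \<Longrightarrow> B j \<in> bounded_ops (Y j)"
    and Y: "\<And>j. j \<in> J \<Longrightarrow> hilbert_subspace (Y j)"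
  shows "opmat_apply J (\<lambda>j q. c j q *\<^sub>C (B j o\<^sub>L S j q)) x \<in> dsum J Y"
proof -
  have "(\<Sum>q\<in>I. blinfun_apply (c j q *\<^sub>C (B j o\<^sub>L S j q)) (x q)) \<in> Y j" if "j \<in> J" for j I
    by (induction I rule: infinite_finite_induct)
      (use Y[OF that] bounded_ops_range[OF B[OF that]] in
        \<open>simp_all add: hilbert_subspace_def scaleC_blinfun.rep_eq\<close>)
  then show ?thesis by (simp add: opmat_apply_def dsum_def)
qed

lemma opmat_selfadjoint_gram:
  assumes range: "\<And>x. opmat_apply J S x \<in> dsum J Y"
    and S: "\<And>x y. dsum_inner J (opmat_apply J S x) y = cinner (v x) (v y :: 'a::complex_hilbert)"
  shows "opmat_selfadjoint J Y S"
proof -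
  have "dsum_inner J x y = cnj (dsum_inner J y x)" for x y :: "'b \<Rightarrow> 'c"
    unfolding dsum_inner_def cnj_sum by (intro sum.cong cinner_commute refl)
  then show ?thesis
    unfolding opmat_selfadjoint_def by (metis range S cinner_commute)
qed

lemma opmat_ge_gram:
  assumes "\<And>x. opmat_apply J S x \<in> dsum J Y" "\<And>x. opmat_apply J T x \<in> dsum J Y"
    and S: "\<And>x y. dsum_inner J (opmat_apply J S x) y = cinner (v x) (v y :: 'a::complex_hilbert)"
    and T: "\<And>x y. dsum_inner J (opmat_apply J T x) y = cinner (w x) (w y :: 'b::complex_hilbert)"
  shows "opmat_ge J Y S T \<longleftrightarrow> (\<forall>x\<in>dsum J Y. norm (w x) \<le> norm (v x))"
proof -
  have "Re (cinner (w x) (w x)) \<le> Re (cinner (v x) (v x)) \<longleftrightarrow> norm (w x) \<le> norm (v x)" for x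
    by (simp add: cinner_self)
  then show ?thesis
    using opmat_selfadjoint_gram[OF assms(1) S] opmat_selfadjoint_gram[OF assms(2) T] unfolding opmat_ge_def S T by blast
qed

section \<open>Necessity of the matrix inequality\<close>

lemma norm_mult_op_le:
  fixes \<theta> :: "'h::complex_hilbert \<Rightarrow>\<^sub>L ('n::finite list, 'k::complex_hilbert) ell2"
  assumes \<theta>: "\<theta> \<in> bounded_ops UNIV" and le: "mult_op_norm k \<theta> \<le> 1" and q: "q \<in> fock_poly k"
  shows "norm (mult_op \<theta> q) \<le> norm q"
proof (cases "q = 0")
  case True
  then show ?thesis by (simp add: mult_op_def coord_zero)
next
  case False
  define c where "c = complex_of_real (1 / norm q)"
  have "c *\<^sub>C q \<in> {q \<in> fock_poly k. norm q \<le> 1}"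
    using q False by (simp add: c_def fock_poly_def coord_scaleC norm_scaleC norm_divide)
  \<comment> \<open>A real supremum is an upper bound only for a bounded family, hence the appeal to
    \<open>mult_op_bounded\<close>.\<close>
  then have "norm (mult_op \<theta> (c *\<^sub>C q)) \<le> mult_op_norm k \<theta>"
    unfolding mult_op_norm_def by (rule cSUP_upper[OF _ mult_op_bounded])
  with le have "cmod c * norm (mult_op \<theta> q) \<le> 1"
    by (simp add: mult_op_scaleC[OF \<theta> q] norm_scaleC)
  then show ?thesis using False by (simp add: c_def norm_divide divide_le_eq)
qed

text \<open>No adjoint of the multiplication operator is formed: \<open>mult_op \<theta> w\<close>
  paired with \<open>v\<close> is the squared norm of \<open>w\<close>, and Cauchy-Schwarz leaves a
  factor \<open>norm w\<close> to cancel.\<close>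

lemma interpolant_imp_le:
  fixes \<theta> :: "'h::complex_hilbert \<Rightarrow>\<^sub>L ('n::finite list, 'k::complex_hilbert) ell2"
    and B :: "nat \<Rightarrow> 'k \<Rightarrow>\<^sub>L 'y::complex_hilbert"
  assumes z: "\<And>j. j \<in> J \<Longrightarrow> norm (z j) < 1"
    and B: "\<And>j. j \<in> J \<Longrightarrow> B j \<in> bounded_ops UNIV"
    and C: "\<And>j. j \<in> J \<Longrightarrow> C j \<in> bounded_ops UNIV"
    and \<theta>: "\<theta> \<in> bounded_ops UNIV" and le: "mult_op_norm k \<theta> \<le> 1"
    and interp: "\<And>j. j \<in> J \<Longrightarrow> B j o\<^sub>L op_eval \<theta> (z j) = C j"
  shows "norm (trunc (Suc k) (kernel_comb J z C y)) \<le> norm (kernel_comb J z B y)"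
proof -
  define v where "v = kernel_comb J z B y"
  define w where "w = trunc (Suc k) (kernel_comb J z C y)"
  have eval: "cinner (\<theta> h) (fock_kernel (z j) \<otimes>\<^sub>2 cadj (B j) (y j)) = cinner h (cadj (C j) (y j))"
    if "j \<in> J" for j h
  proof -
    have "C j h = B j (op_eval \<theta> (z j) h)" by (simp flip: interp[OF that])
    with that show ?thesis by (simp add: z cinner_op_eval[symmetric] flip: cinner_cadj[OF B] cinner_cadj[OF C])
  qed
  have w: "w \<in> fock_poly k"
    by (simp add: w_def fock_poly_def coord_trunc)
  \<comment> \<open>The eigenvector property of the kernels turns each \<open>creation_word\<close>
    into a scalar, and \<open>eval\<close> replaces \<open>B\<close> by \<open>C\<close>.\<close>
  have "cinner (mult_op \<theta> w) v =
      (\<Sum>\<alpha> | length \<alpha> \<le> k. \<Sum>j\<in>J. monomial_at (z j) \<alpha> * cinner (coord w \<alpha>) (cadj (C j) (y j)))"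
    unfolding mult_op_altdef[OF w] v_def kernel_comb_def cinner_sum_left cinner_sum_right
    by (subst sum.swap, intro sum.cong) (simp_all add: cinner_creation_word_kernel z eval)
  also have "\<dots> = cinner w w"
    unfolding w_def cinner_trunc less_Suc_eq_le
    by (simp add: kernel_comb_def coord_sum cinner_sum_right coord_tensor coord_fock_kernel z
        cinner_scaleC_right)
  finally have "complex_of_real ((norm w)\<^sup>2) = cinner (mult_op \<theta> w) v" by (simp add: cinner_self)
  then have "(norm w)\<^sup>2 = cmod (cinner (mult_op \<theta> w) v)"
    by (metis abs_of_nonneg norm_of_real zero_le_power2)
  also have "\<dots> \<le> norm (mult_op \<theta> w) * norm v" by (rule cauchy_schwarz_cinner)
  also have "\<dots> \<le> norm w * norm v"
    by (intro mult_right_mono norm_mult_op_le[OF \<theta> le w]) simp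
  finally have "norm w * norm w \<le> norm w * norm v" by (simp add: power2_eq_square)
  then show ?thesis
    unfolding v_def[symmetric] w_def[symmetric] by (cases "w = 0") simp_all
qed

section \<open>Sufficiency of the matrix inequality\<close>

lemma le_imp_interpolant:
  fixes B :: "nat \<Rightarrow> 'k::complex_hilbert \<Rightarrow>\<^sub>L 'y::complex_hilbert"
    and C :: "nat \<Rightarrow> 'h::complex_hilbert \<Rightarrow>\<^sub>L 'y"
    and z :: "nat \<Rightarrow> complex ^ 'n::finite"
  assumes J: "finite J" and z: "\<And>j. j \<in> J \<Longrightarrow> norm (z j) < 1"
    and Y: "\<And>j. j \<in> J \<Longrightarrow> hilbert_subspace (Y j)"
    and B: "\<And>j. j \<in> J \<Longrightarrow> B j \<in> bounded_ops (Y j)"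
    and C: "\<And>j. j \<in> J \<Longrightarrow> C j \<in> bounded_ops (Y j)"
    and le: "\<And>y. y \<in> dsum J Y \<Longrightarrow>
      norm (trunc (Suc k) (kernel_comb J z C y)) \<le> norm (kernel_comb J z B y)"
  obtains \<theta> :: "'h \<Rightarrow>\<^sub>L ('n list, 'k) ell2" where "\<theta> \<in> bounded_ops UNIV" "mult_op_norm k \<theta> \<le> 1"
    "\<And>j. j \<in> J \<Longrightarrow> B j o\<^sub>L op_eval \<theta> (z j) = C j"
proof -
  note B' = bounded_ops_UNIV[OF B] and C' = bounded_ops_UNIV[OF C]
  \<comment> \<open>Members of \<open>dsum J Y\<close> are fixed outside \<open>J\<close>; leaving
    those values free makes the set closed under pointwise operations.\<close>
  define V where "V = {y. \<forall>j\<in>J. y j \<in> Y j}"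
  define v where "v = kernel_comb J z B"
  define w where "w y = trunc (Suc k) (kernel_comb J z C y)" for y
  have V_add: "(\<lambda>j. x j + y j) \<in> V" if "x \<in> V" "y \<in> V" for x y
    using that Y by (simp add: V_def hilbert_subspace_def)
  have V_scale: "(\<lambda>j. c j *\<^sub>C y j) \<in> V" if "y \<in> V" for c y
    using that Y by (simp add: V_def hilbert_subspace_def)
  have wv: "norm (w y) \<le> norm (v y)" if "y \<in> V" for y
  proof -
    have "restrict y J \<in> dsum J Y" using that by (auto simp: V_def dsum_def)
    then have "norm (w (restrict y J)) \<le> norm (v (restrict y J))"
      unfolding w_def v_def by (rule le)
    moreover have "w (restrict y J) = w y" "v (restrict y J) = v y"
      by (simp_all add: w_def v_def kernel_comb_def)
    ultimately show ?thesis by simp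
  qed
  have v_add: "v (\<lambda>j. x j + y j) = v x + v y" and w_add: "w (\<lambda>j. x j + y j) = w x + w y" for x y
    by (simp_all add: v_def w_def kernel_comb_add trunc_add)
  have v_scale: "v (\<lambda>j. c *\<^sub>C y j) = c *\<^sub>C v y" and w_scale: "w (\<lambda>j. c *\<^sub>C y j) = c *\<^sub>C w y" for c y
    by (simp_all add: v_def w_def kernel_comb_scaleC[OF B'] kernel_comb_scaleC[OF C'] trunc_scaleC)
  have v_ann: "annihilation i (v y) = v (\<lambda>j. cnj (z j $ i) *\<^sub>C y j)" for i y
    unfolding v_def by (rule annihilation_kernel_comb[OF B' z])
  \<comment> \<open>Annihilation lowers the degree by one, so the cutoff falls from
    \<open>Suc k\<close> to \<open>k\<close>. This is why intertwining holds only below degree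
    \<open>k\<close>.\<close>
  have w_ann: "annihilation i (w y) = trunc k (w (\<lambda>j. cnj (z j $ i) *\<^sub>C y j))" for i y
    by (simp add: w_def annihilation_trunc annihilation_kernel_comb[OF C' z] trunc_trunc)
  define G where "G = (\<lambda>y. (v y, w y)) ` V"
  have "csubspace G"
    unfolding csubspace_def
  proof (intro conjI ballI allI)
    have "(\<lambda>j. 0) \<in> V" using Y by (simp add: V_def hilbert_subspace_def)
    then show "0 \<in> G"
      using v_scale[of 0 "\<lambda>j. 0"] w_scale[of 0 "\<lambda>j. 0"] unfolding G_def
      by (intro image_eqI[of _ _ "\<lambda>j. 0"]) (simp_all add: zero_prod_def)
    fix a assume "a \<in> G"
    then obtain x where x: "x \<in> V" "a = (v x, w x)" unfolding G_def by blast
    show "c *\<^sub>C a \<in> G" for c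
      unfolding G_def using x
      by (intro image_eqI[of _ _ "\<lambda>j. c *\<^sub>C x j"])
        (simp_all add: V_scale v_scale w_scale scaleC_prod_def)
    fix b assume "b \<in> G"
    then obtain y where y: "y \<in> V" "b = (v y, w y)" unfolding G_def by blast
    show "a + b \<in> G"
      unfolding G_def using x y
      by (intro image_eqI[of _ _ "\<lambda>j. x j + y j"]) (simp_all add: V_add v_add w_add)
  qed
  moreover have "norm b \<le> norm a" if "(a, b) \<in> G" for a b
    using that wv by (auto simp: G_def)
  ultimately obtain \<Gamma> :: "('n list, 'k) ell2 \<Rightarrow>\<^sub>L ('n list, 'h) ell2"
    where \<Gamma>: "\<Gamma> \<in> bounded_ops UNIV" and \<Gamma>_le: "\<And>x. norm (\<Gamma> x) \<le> norm x"
      and \<Gamma>_eq: "\<And>x y. (x, y) \<in> G \<Longrightarrow> \<Gamma> x = y"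
      and \<Gamma>_0: "\<And>x. \<forall>(u, y)\<in>G. cinner x u = 0 \<Longrightarrow> \<Gamma> x = 0"
    by (rule contraction_extension) (assumption, rule that)
  have \<Gamma>_v: "\<Gamma> (v y) = w y" if "y \<in> V" for y
    using that by (intro \<Gamma>_eq) (auto simp: G_def)
  define T where "T = cadj \<Gamma>"
  obtain \<theta> :: "'h \<Rightarrow>\<^sub>L ('n list, 'k) ell2" where \<theta>: "\<theta> \<in> bounded_ops UNIV" "mult_op_norm k \<theta> \<le> 1"
    and \<theta>_eq: "\<And>h u. u \<in> v ` V \<Longrightarrow> cinner (\<theta> h) u = cinner (T (single [] h)) u"
  proof (rule relaxed_lifting[of T "v ` V" k])
    show "T \<in> bounded_ops UNIV" unfolding T_def by (rule cadj_bounded_ops[OF \<Gamma>])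
    show "norm (T q) \<le> norm q" for q unfolding T_def by (rule norm_cadj_apply_le[OF \<Gamma> \<Gamma>_le])
    show "annihilation i u \<in> v ` V" if "u \<in> v ` V" for u i
      using that V_scale by (auto simp: v_ann)
    \<comment> \<open>Vanishing of \<open>\<Gamma>\<close> on the complement of its domain becomes,
      for the adjoint, the range condition.\<close>
    show "cinner x (T q) = 0" if "\<And>u. u \<in> v ` V \<Longrightarrow> cinner x u = 0" for x q
    proof -
      have "\<Gamma> x = 0" using that by (intro \<Gamma>_0) (auto simp: G_def)
      then show ?thesis by (simp add: T_def cinner_cadj[OF \<Gamma>, symmetric])
    qed
    show "cinner (T (creation i q)) u = cinner (creation i (T q)) u"
      if q: "trunc k q = q" and u: "u \<in> v ` V" for q u i
    proof -
      obtain y where y: "y \<in> V" "u = v y" using u by blast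
      define x where "x = (\<lambda>j. cnj (z j $ i) *\<^sub>C y j)"
      have x: "x \<in> V" unfolding x_def by (rule V_scale[OF y(1)])
      \<comment> \<open>The remaining truncation can be moved onto \<open>q\<close>, where it acts
        as the identity.\<close>
      have "cinner (T (creation i q)) u = cinner q (trunc k (w x))"
        by (simp add: T_def y cinner_cadj_left[OF \<Gamma>] \<Gamma>_v cinner_creation w_ann x_def)
      also have "\<dots> = cinner q (w x)" by (simp add: q flip: cinner_trunc_left)
      also have "\<dots> = cinner (creation i (T q)) u"
        using x by (simp add: T_def y(2) cinner_creation v_ann cinner_cadj_left[OF \<Gamma>] \<Gamma>_v flip: x_def)
      finally show ?thesis .
    qed
  qed (rule that)
  have "B j o\<^sub>L op_eval \<theta> (z j) = C j" if j: "j \<in> J" for j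
  proof (rule blinfun_eqI)
    fix h
    define d where "d = B j (op_eval \<theta> (z j) h) - C j h"
    \<comment> \<open>Testing against \<open>Y j\<close> suffices because \<open>d\<close> itself
      lies in \<open>Y j\<close>.\<close>
    have "cinner d y = 0" if y: "y \<in> Y j" for y
    proof -
      define y' where "y' = (\<lambda>i. if i = j then y else 0)"
      have y': "y' \<in> V" using y Y by (simp add: y'_def V_def hilbert_subspace_def)
      have "cinner (B j (op_eval \<theta> (z j) h)) y = cinner (\<theta> h) (v y')"
        by (simp add: v_def y'_def kernel_comb_delta J j cinner_cadj[OF B'] cinner_op_eval z)
      also have "\<dots> = cinner (single [] h) (w y')"
        using y' by (simp add: \<theta>_eq T_def cinner_cadj_left[OF \<Gamma>] \<Gamma>_v)
      \<comment> \<open>\<open>single [] h\<close> reads the constant term, where the monomial is 1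
        and the cutoff \<open>Suc k\<close> keeps degree 0 even for \<open>k = 0\<close>.\<close>
      also have "\<dots> = cinner (C j h) y"
        by (simp add: w_def y'_def kernel_comb_delta J j cinner_single coord_trunc coord_tensor
            coord_fock_kernel z cinner_cadj[OF C'])
      finally show ?thesis by (simp add: d_def cinner_diff_left)
    qed
    moreover have "d \<in> Y j"
    proof -
      have "csubspace (Y j)" using Y[OF j] by (simp add: hilbert_subspace_def csubspace_def)
      then show ?thesis
        unfolding d_def by (intro csubspace_diff bounded_ops_range B C j)
    qed
    ultimately have "cinner d d = 0" by blast
    then show "(B j o\<^sub>L op_eval \<theta> (z j)) h = C j h" by (simp add: cinner_self d_def)
  qed
  with \<theta> show thesis by (rule that)
qed

theorem corollary3p8:
  fixes z :: "nat \<Rightarrow> complex ^ 'n::finite"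
    and Y :: "nat \<Rightarrow> 'y::complex_hilbert set"
    and B :: "nat \<Rightarrow> 'k::complex_hilbert \<Rightarrow>\<^sub>L 'y"
    and C :: "nat \<Rightarrow> 'h::complex_hilbert \<Rightarrow>\<^sub>L 'y"
    and m k :: nat
  assumes "m \<ge> 1"
    and "\<And>j. j \<in> {1..m} \<Longrightarrow> z j \<in> ball 0 1"
    and "inj_on z {1..m}"
    and "\<And>j. j \<in> {1..m} \<Longrightarrow> hilbert_subspace (Y j)"
    and "\<And>j. j \<in> {1..m} \<Longrightarrow> B j \<in> bounded_ops (Y j)"
    and "\<And>j. j \<in> {1..m} \<Longrightarrow> C j \<in> bounded_ops (Y j)"
  shows "(\<exists>\<theta> :: 'h \<Rightarrow>\<^sub>L ('n list, 'k) ell2. \<theta> \<in> bounded_ops UNIV \<and>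
            (\<forall>j\<in>{1..m}. B j o\<^sub>L op_eval \<theta> (z j) = C j) \<and> mult_op_norm k \<theta> \<le> 1)
     \<longleftrightarrow>
     opmat_ge {1..m} Y
       (\<lambda>j q. (1 / (1 - cinner (z j) (z q))) *\<^sub>C (B j o\<^sub>L cadj (B q)))
       (\<lambda>j q. ((1 - cinner (z j) (z q) ^ (k + 1)) / (1 - cinner (z j) (z q))) *\<^sub>C
               (C j o\<^sub>L cadj (C q)))"
proof -
  let ?J = "{1..m}"
  have z: "norm (z j) < 1" if "j \<in> ?J" for j using assms(2)[OF that] by simp
  note B = assms(5) and C = assms(6)
  note B' = bounded_ops_UNIV[OF B] and C' = bounded_ops_UNIV[OF C]
  have gram_B: "dsum_inner ?J (opmat_apply ?J
        (\<lambda>j q. (1 / (1 - cinner (z j) (z q))) *\<^sub>C (B j o\<^sub>L cadj (B q))) x) y =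
      cinner (kernel_comb ?J z B x) (kernel_comb ?J z B y)" for x y
    by (rule dsum_inner_gram[where P = "\<lambda>f. f"]) (simp_all add: B' z cinner_kernel)
  have gram_C: "dsum_inner ?J (opmat_apply ?J
        (\<lambda>j q. ((1 - cinner (z j) (z q) ^ (k + 1)) / (1 - cinner (z j) (z q))) *\<^sub>C
          (C j o\<^sub>L cadj (C q))) x) y =
      cinner (trunc (Suc k) (kernel_comb ?J z C x)) (trunc (Suc k) (kernel_comb ?J z C y))" for x y
    \<comment> \<open>Truncation is self-adjoint and idempotent, so one copy of it in the second
      argument is enough.\<close>
    unfolding cinner_trunc_left trunc_trunc min.idem
    by (rule dsum_inner_gram[where P = "trunc (Suc k)"])
      (simp_all only: C' trunc_sum cinner_kernel_trunc z Suc_eq_plus1)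
  have range_B: "opmat_apply ?J (\<lambda>j q. c j q *\<^sub>C (B j o\<^sub>L cadj (B q))) x \<in> dsum ?J Y"
    and range_C: "opmat_apply ?J (\<lambda>j q. c j q *\<^sub>C (C j o\<^sub>L cadj (C q))) x \<in> dsum ?J Y" for c x
    by (rule opmat_apply_dsum; rule B C assms(4); assumption)+
  show ?thesis
    unfolding opmat_ge_gram[OF range_B range_C gram_B gram_C]
  proof
    assume "\<exists>\<theta> :: 'h \<Rightarrow>\<^sub>L ('n list, 'k) ell2. \<theta> \<in> bounded_ops UNIV \<and>
            (\<forall>j\<in>?J. B j o\<^sub>L op_eval \<theta> (z j) = C j) \<and> mult_op_norm k \<theta> \<le> 1"
    then show "\<forall>y\<in>dsum ?J Y.
        norm (trunc (Suc k) (kernel_comb ?J z C y)) \<le> norm (kernel_comb ?J z B y)"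
      using interpolant_imp_le[where J = ?J and z = z and B = B and C = C, OF z B' C'] by blast
  next
    assume "\<forall>y\<in>dsum ?J Y.
        norm (trunc (Suc k) (kernel_comb ?J z C y)) \<le> norm (kernel_comb ?J z B y)"
    then obtain \<theta> :: "'h \<Rightarrow>\<^sub>L ('n list, 'k) ell2" where "\<theta> \<in> bounded_ops UNIV" "mult_op_norm k \<theta> \<le> 1"
      "\<And>j. j \<in> ?J \<Longrightarrow> B j o\<^sub>L op_eval \<theta> (z j) = C j"
      using le_imp_interpolant[where J = ?J and k = k and z = z and B = B and C = C and Y = Y, OF _ z assms(4) B C] by auto
    then show "\<exists>\<theta> :: 'h \<Rightarrow>\<^sub>L ('n list, 'k) ell2. \<theta> \<in> bounded_ops UNIV \<and>
            (\<forall>j\<in>?J. B j o\<^sub>L op_eval \<theta> (z j) = C j) \<and> mult_op_norm k \<theta> \<le> 1"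
      by blast
  qed
qed

end
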